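(* Let $(x_t)_{t\in[0,T]}$ and $(\tilde x_t)_{t\in[0,T]}$ be PDPs with characteristics $(\Phi,\lambda,Q)$ and $(\Phi,\tilde\lambda,\tilde Q)$ respectively, constructed by thinning from the same data $(N^*_t),(U_k),(V_k)$ and with the same initial point $x\in E$. Assume that $\tilde\lambda$ and $\tilde Q$ depend only on $\theta$, that $\tilde Q$ is always positive, i.e. $\tilde Q(\theta,\theta')>0$ for all $\theta,\theta'\in\Theta$, and that $0<\tilde\lambda(\theta)<\lambda^*$ for all $\theta\in\Theta$. Let $t\in[0,T]$ and put $\kappa_0=1$ and $\kappa_\ell=\dfrac{Q(\tilde x^-_{T^*_{\tilde\tau_\ell}},\tilde\theta_\ell)}{\tilde Q(\tilde\theta_{\ell-1},\tilde\theta_\ell)}$ for $\ell\ge1$, where $\tilde x^-_{T^*_{\tilde\tau_\ell}}=(\tilde\theta_{\ell-1},\tilde\nu_\ell)$. For every integer $n\ge0$, define on the event $\{\tilde N_t=n\}$ $$\tilde Z_n=\kappa_n\left(\Big(1-\frac{\tilde\lambda(\tilde\theta_n)}{\lambda^*}\Big)^{N^*_t-\tilde\tau_n}\right)^{-1}\prod_{q=\tilde\tau_n+1}^{N^*_t}\left(1-\frac{\lambda(\tilde\theta_n,\Phi_{\tilde\theta_n}(T^*_q-T^*_{\tilde\tau_n},\tilde\nu_n))}{\lambda^*}\right)$$ (the product being $1$ if $\tilde\tau_n=N^*_t$), and for $0\le\ell\le n-1$ $$\tilde Z_\ell=\kappa_\ell\left(\frac{\tilde\lambda(\tilde\theta_\ell)}{\lambda^*}\Big(1-\frac{\tilde\lambda(\tilde\theta_\ell)}{\lambda^*}\Big)^{\tilde\tau_{\ell+1}-\tilde\tau_\ell-1}\right)^{-1}\frac{\lambda(\tilde\theta_\ell,\Phi_{\tilde\theta_\ell}(T^*_{\tilde\tau_{\ell+1}}-T^*_{\tilde\tau_\ell},\tilde\nu_\ell))}{\lambda^*}\prod_{q=\tilde\tau_\ell+1}^{\tilde\tau_{\ell+1}-1}\left(1-\frac{\lambda(\tilde\theta_\ell,\Phi_{\tilde\theta_\ell}(T^*_q-T^*_{\tilde\tau_\ell},\tilde\nu_\ell))}{\lambda^*}\right),$$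 and $\tilde R_n=\tilde Z_n\prod_{\ell=0}^{n-1}\tilde Z_\ell$. Then for all $n\ge0$ and every bounded measurable $g:E\to\mathbb R$, $$\mathbb E\left[g(\tilde x_t)\,\tilde R_n\,\mathbf 1_{\{\tilde N_t=n\}}\right]=\mathbb E\left[g(x_t)\,\mathbf 1_{\{N_t=n\}}\right].$$
   Context: Let $\Theta=\{k_1,\dots,k_{|\Theta|}\}$ be a finite or countable set and $E=\Theta\times\mathbb R$; elements of $E$ are written $x=(\theta,\nu)$. A piecewise deterministic process (PDP) is specified by characteristics $(\Phi,\lambda,Q)$: (Borel measurable) functions $\Phi_\theta:\mathbb R_+\times\mathbb R\to\mathbb R$, $\theta\in\Theta$; a measurable function $\lambda:E\to(0,\infty)$; a transition kernel $Q$ on $E$ of the form $Q((\theta,\nu),A\times B)=Q((\theta,\nu),A)\,\delta_\nu(B)$ for $A\subseteq\Theta$, $B\in\mathcal B(\mathbb R)$ (only the $\theta$-component jumps). We write $Q(x,\theta')=Q(x,\{\theta'\})$. Standing assumption: there is a constant $\lambda^*<\infty$ with $\lambda(x)\le\lambda^*$ for all $x\in E$. If $\tilde\lambda,\tilde Q$ depend only on $\theta$ we write $\tilde\lambda(\theta)$ and $\tilde Q(\theta,\theta')$ for $\tilde\lambda(\theta,\nu)$ and $\tilde Q((\theta,\nu),\{\theta'\})$. Data: on a probability space, a homogeneous Poisson process $(N^*_t)_{t\ge0}$ with intensity $\lambda^*$ and jump times $(T^*_k)_{k\ge1}$, $T^*_0=0$; two i.i.d. sequences $(U_k)_{k\ge1}$,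 $(V_k)_{k\ge1}$ of uniform variables on $[0,1]$, independent of each other and of $(T^*_k)$. Construction by thinning: let $a_0=0$, $a_j(x)=\sum_{i=1}^jQ(x,\{k_i\})$ and $H(x,u)=\sum_i k_i\mathbf 1_{a_{i-1}(x)<u\le a_i(x)}$. Start from $(\theta_0,\nu_0)\in E$, $T_0=0$, $\tau_0=0$. For $n\ge1$, $$\tau_n=\inf\{k>\tau_{n-1}:U_k\lambda^*\le\lambda(\theta_{n-1},\Phi_{\theta_{n-1}}(T^*_k-T^*_{\tau_{n-1}},\nu_{n-1}))\},\qquad T_n=T^*_{\tau_n},$$ $$\nu_n=\Phi_{\theta_{n-1}}(T_n-T_{n-1},\nu_{n-1}),\qquad \theta_n=H((\theta_{n-1},\nu_n),V_n)$$ (with $T_n=\infty$ if the set is empty). The PDP is $x_t=(\theta_n,\Phi_{\theta_n}(t-T_n,\nu_n))$ for $t\in[T_n,T_{n+1})$, with $x_0=(\theta_0,\nu_0)$, and $N_t=\sum_{n\ge1}\mathbf 1_{T_n\le t}$. For $(\tilde x_t)$ the corresponding objects are denoted $\tilde\tau_n,\tilde T_n,\tilde\theta_n,\tilde\nu_n,\tilde N_t$ (with its own characteristics in place of $(\Phi,\lambda,Q)$). *)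

theory Defs
  imports "HOL-Probability.Probability"
begin

(* The mode set Theta is a whole type 'k, made finite or countable by an enumeration
   k_1, k_2, ... whose index set I is {1..|Theta|} or {1..}. *)

definition enumeration :: "(nat \<Rightarrow> 'k) \<Rightarrow> nat set \<Rightarrow> bool" where
  "enumeration k I \<longleftrightarrow> (I = {1..} \<or> (\<exists>m. I = {1..m})) \<and> bij_betw k I UNIV"

definition state_space :: "('k \<times> real) measure" where
  "state_space = count_space UNIV \<Otimes>\<^sub>M borel"

(* Q(x, A) for a set A of modes *)
definition mode_prob :: "('k \<times> real \<Rightarrow> ('k \<times> real) measure) \<Rightarrow> 'k \<times> real \<Rightarrow> 'k set \<Rightarrow> real" where
  "mode_prob Q x A = measure (Q x) (A \<times> UNIV)"

definition pdp_characteristics ::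
  "('k \<Rightarrow> real \<Rightarrow> real \<Rightarrow> real) \<Rightarrow> ('k \<times> real \<Rightarrow> real) \<Rightarrow> ('k \<times> real \<Rightarrow> ('k \<times> real) measure) \<Rightarrow> bool" where
  "pdp_characteristics \<Phi> lam Q \<longleftrightarrow>
     (\<forall>\<theta>. (\<lambda>(t, \<nu>). \<Phi> \<theta> t \<nu>) \<in> borel_measurable (restrict_space borel {0..} \<Otimes>\<^sub>M borel)) \<and>
     lam \<in> borel_measurable state_space \<and> (\<forall>x. 0 < lam x) \<and>
     Q \<in> state_space \<rightarrow>\<^sub>M prob_algebra state_space \<and>
     (\<forall>\<theta> \<nu> A. \<forall>B \<in> sets borel.
        measure (Q (\<theta>, \<nu>)) (A \<times> B) = mode_prob Q (\<theta>, \<nu>) A * indicator B \<nu>)"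


(* T 1 < T 2 < ... are the jump times of the counting path N; T 0 = 0 is a convention.
   Since T tends to infinity, the set whose cardinality is taken is finite. *)
definition jump_times :: "(real \<Rightarrow> nat) \<Rightarrow> (nat \<Rightarrow> real) \<Rightarrow> bool" where
  "jump_times N T \<longleftrightarrow>
     T 0 = 0 \<and> strict_mono T \<and> filterlim T at_top sequentially \<and>
     (\<forall>t\<ge>0. N t = card {k. 1 \<le> k \<and> T k \<le> t})"

context prob_space
begin

(* Homogeneous Poisson process N with intensity l and jump times T. By jump_times, the paths
   of N are right-continuous, start at 0 and are nondecreasing, so that the subtraction
   on nat is exact. *)
definition poisson_process :: "real \<Rightarrow> ('a \<Rightarrow> real \<Rightarrow> nat) \<Rightarrow> ('a \<Rightarrow> nat \<Rightarrow> real) \<Rightarrow> bool" where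
  "poisson_process l N T \<longleftrightarrow>
     0 < l \<and>
     (\<forall>t\<ge>0. (\<lambda>\<omega>. N \<omega> t) \<in> M \<rightarrow>\<^sub>M count_space UNIV) \<and>
     (\<forall>\<omega>\<in>space M. jump_times (N \<omega>) (T \<omega>)) \<and>
     (\<forall>s t. 0 \<le> s \<and> s < t \<longrightarrow>
        distr M (count_space UNIV) (\<lambda>\<omega>. N \<omega> t - N \<omega> s) = measure_pmf (poisson_pmf (l * (t - s)))) \<and>
     (\<forall>ts m. 0 \<le> ts 0 \<and> mono ts \<longrightarrow>
        indep_vars (\<lambda>_. count_space UNIV) (\<lambda>i \<omega>. N \<omega> (ts (Suc i)) - N \<omega> (ts i)) {..<m::nat})"

definition iid_uniform :: "('a \<Rightarrow> nat \<Rightarrow> real) \<Rightarrow> bool" where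
  "iid_uniform U \<longleftrightarrow>
     indep_vars (\<lambda>_. borel) (\<lambda>k \<omega>. U \<omega> k) {1..} \<and>
     (\<forall>k\<ge>1. distr M borel (\<lambda>\<omega>. U \<omega> k) = uniform_measure lborel {0..1})"

(* The last conjunct: the sequences T, U and V (indexed from 1) are mutually independent. *)
definition thinning_data ::
  "real \<Rightarrow> ('a \<Rightarrow> real \<Rightarrow> nat) \<Rightarrow> ('a \<Rightarrow> nat \<Rightarrow> real) \<Rightarrow> ('a \<Rightarrow> nat \<Rightarrow> real) \<Rightarrow> ('a \<Rightarrow> nat \<Rightarrow> real) \<Rightarrow> bool" where
  "thinning_data l N T U V \<longleftrightarrow>
     poisson_process l N T \<and> iid_uniform U \<and> iid_uniform V \<and>
     indep_vars (\<lambda>_. \<Pi>\<^sub>M k\<in>{1..}. borel) (\<lambda>i \<omega>. restrict (([T, U, V] ! i) \<omega>) {1..}) {..<3}"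

end


(* H(x, u). At most one index qualifies. None does for u = 0, nor for u = 1 if the partial
   sums never reach 1; H is then an unspecified mode, which concerns a null set of u only. *)
definition select_mode ::
  "(nat \<Rightarrow> 'k) \<Rightarrow> nat set \<Rightarrow> ('k \<times> real \<Rightarrow> ('k \<times> real) measure) \<Rightarrow> 'k \<times> real \<Rightarrow> real \<Rightarrow> 'k" where
  "select_mode k I Q x u =
     (let a = (\<lambda>j. \<Sum>i=1..j. mode_prob Q x {k i})
      in k (THE i. i \<in> I \<and> a (i - 1) < u \<and> u \<le> a i))"

(* The sequence (tau_n, theta_n, nu_n) for one realisation T, U, V of the data. Inf {} = \<infinity> in
   enat; from the first n with tau_n = \<infinity> on, the other two components are never used. *)
primrec thinning ::
  "real \<Rightarrow> (nat \<Rightarrow> 'k) \<Rightarrow> nat set \<Rightarrow>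
   ('k \<Rightarrow> real \<Rightarrow> real \<Rightarrow> real) \<Rightarrow> ('k \<times> real \<Rightarrow> real) \<Rightarrow> ('k \<times> real \<Rightarrow> ('k \<times> real) measure) \<Rightarrow>
   'k \<times> real \<Rightarrow> (nat \<Rightarrow> real) \<Rightarrow> (nat \<Rightarrow> real) \<Rightarrow> (nat \<Rightarrow> real) \<Rightarrow> nat \<Rightarrow> enat \<times> 'k \<times> real" where
  "thinning l k I \<Phi> lam Q x T U V 0 = (0, x)"
| "thinning l k I \<Phi> lam Q x T U V (Suc n) =
     (let (\<tau>, \<theta>, \<nu>) = thinning l k I \<Phi> lam Q x T U V n;
          flow = (\<lambda>j. \<Phi> \<theta> (T j - T (the_enat \<tau>)) \<nu>)
      in case Inf {enat j | j. \<tau> < enat j \<and> U j * l \<le> lam (\<theta>, flow j)} of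
           enat j \<Rightarrow> (enat j, select_mode k I Q (\<theta>, flow j) (V (Suc n)), flow j)
         | \<infinity> \<Rightarrow> (\<infinity>, \<theta>, \<nu>))"

(* Below, S is a sequence produced by thinning from the data T, U, V. *)

definition tau :: "(nat \<Rightarrow> enat \<times> 'k \<times> real) \<Rightarrow> nat \<Rightarrow> nat" where
  "tau S n = the_enat (fst (S n))"

definition mode :: "(nat \<Rightarrow> enat \<times> 'k \<times> real) \<Rightarrow> nat \<Rightarrow> 'k" where
  "mode S n = fst (snd (S n))"

definition pos :: "(nat \<Rightarrow> enat \<times> 'k \<times> real) \<Rightarrow> nat \<Rightarrow> real" where
  "pos S n = snd (snd (S n))"

definition jump_time :: "(nat \<Rightarrow> real) \<Rightarrow> (nat \<Rightarrow> enat \<times> 'k \<times> real) \<Rightarrow> nat \<Rightarrow> ereal" where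
  "jump_time T S n = (case fst (S n) of enat j \<Rightarrow> ereal (T j) | \<infinity> \<Rightarrow> \<infinity>)"

definition jump_count :: "(nat \<Rightarrow> real) \<Rightarrow> (nat \<Rightarrow> enat \<times> 'k \<times> real) \<Rightarrow> real \<Rightarrow> nat" where
  "jump_count T S t = card {n. 1 \<le> n \<and> jump_time T S n \<le> ereal t}"

(* No flow property is assumed, so \<Phi> \<theta> 0 \<nu> = \<nu> may fail: the value x at time 0 is imposed. *)
definition pdp ::
  "('k \<Rightarrow> real \<Rightarrow> real \<Rightarrow> real) \<Rightarrow> 'k \<times> real \<Rightarrow> (nat \<Rightarrow> real) \<Rightarrow> (nat \<Rightarrow> enat \<times> 'k \<times> real) \<Rightarrow> real \<Rightarrow> 'k \<times> real" where
  "pdp \<Phi> x T S t =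
     (if t = 0 then x
      else let n = (THE n. jump_time T S n \<le> ereal t \<and> ereal t < jump_time T S (Suc n))
           in (mode S n, \<Phi> (mode S n) (t - T (tau S n)) (pos S n)))"


(* The factors Z_l and Z_n of the likelihood ratio. The characteristics (lam, Q) are those of
   the target process; lamt, qt and S are the rate, the mode transition probabilities
   and the thinning sequence of the reference process; m is the value of N* at time t. *)

definition kappa ::
  "('k \<times> real \<Rightarrow> ('k \<times> real) measure) \<Rightarrow> ('k \<Rightarrow> 'k \<Rightarrow> real) \<Rightarrow> (nat \<Rightarrow> enat \<times> 'k \<times> real) \<Rightarrow> nat \<Rightarrow> real" where
  "kappa Q qt S l =
     (if l = 0 then 1
      else mode_prob Q (mode S (l - 1), pos S l) {mode S l} / qt (mode S (l - 1)) (mode S l))"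

(* lambda at the q-th point of N*, along the flow started at the l-th jump *)
definition rate_at ::
  "('k \<Rightarrow> real \<Rightarrow> real \<Rightarrow> real) \<Rightarrow> ('k \<times> real \<Rightarrow> real) \<Rightarrow> (nat \<Rightarrow> real) \<Rightarrow> (nat \<Rightarrow> enat \<times> 'k \<times> real) \<Rightarrow> nat \<Rightarrow> nat \<Rightarrow> real" where
  "rate_at \<Phi> lam T S l q = lam (mode S l, \<Phi> (mode S l) (T q - T (tau S l)) (pos S l))"

definition Z_last ::
  "real \<Rightarrow> ('k \<Rightarrow> real \<Rightarrow> real \<Rightarrow> real) \<Rightarrow> ('k \<times> real \<Rightarrow> real) \<Rightarrow> ('k \<times> real \<Rightarrow> ('k \<times> real) measure) \<Rightarrow>
   ('k \<Rightarrow> real) \<Rightarrow> ('k \<Rightarrow> 'k \<Rightarrow> real) \<Rightarrow> (nat \<Rightarrow> real) \<Rightarrow> nat \<Rightarrow> (nat \<Rightarrow> enat \<times> 'k \<times> real) \<Rightarrow> nat \<Rightarrow> real" where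
  "Z_last ls \<Phi> lam Q lamt qt T m S n =
     kappa Q qt S n
     * inverse ((1 - lamt (mode S n) / ls) ^ (m - tau S n))
     * (\<Prod>q = tau S n + 1..m. 1 - rate_at \<Phi> lam T S n q / ls)"

definition Z_inner ::
  "real \<Rightarrow> ('k \<Rightarrow> real \<Rightarrow> real \<Rightarrow> real) \<Rightarrow> ('k \<times> real \<Rightarrow> real) \<Rightarrow> ('k \<times> real \<Rightarrow> ('k \<times> real) measure) \<Rightarrow>
   ('k \<Rightarrow> real) \<Rightarrow> ('k \<Rightarrow> 'k \<Rightarrow> real) \<Rightarrow> (nat \<Rightarrow> real) \<Rightarrow> (nat \<Rightarrow> enat \<times> 'k \<times> real) \<Rightarrow> nat \<Rightarrow> real" where
  "Z_inner ls \<Phi> lam Q lamt qt T S l =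
     kappa Q qt S l
     * inverse (lamt (mode S l) / ls
                * (1 - lamt (mode S l) / ls) ^ (tau S (l + 1) - tau S l - 1))
     * (rate_at \<Phi> lam T S l (tau S (l + 1)) / ls)
     * (\<Prod>q = tau S l + 1..tau S (l + 1) - 1. 1 - rate_at \<Phi> lam T S l q / ls)"

definition likelihood_ratio ::
  "real \<Rightarrow> ('k \<Rightarrow> real \<Rightarrow> real \<Rightarrow> real) \<Rightarrow> ('k \<times> real \<Rightarrow> real) \<Rightarrow> ('k \<times> real \<Rightarrow> ('k \<times> real) measure) \<Rightarrow>
   ('k \<Rightarrow> real) \<Rightarrow> ('k \<Rightarrow> 'k \<Rightarrow> real) \<Rightarrow> (nat \<Rightarrow> real) \<Rightarrow> nat \<Rightarrow> (nat \<Rightarrow> enat \<times> 'k \<times> real) \<Rightarrow> nat \<Rightarrow> real" where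
  "likelihood_ratio ls \<Phi> lam Q lamt qt T m S n =
     Z_last ls \<Phi> lam Q lamt qt T m S n * (\<Prod>l<n. Z_inner ls \<Phi> lam Q lamt qt T S l)"

end

theory Submission
  imports Defs
begin

text \<open>
  Condition on the arrival times of \<open>N\<^sup>*\<close>. Up to time \<open>t\<close>, the thinning then depends only on which of
  the finitely many arrivals are accepted and which modes are selected, i.e. on a path in a
  countable set. Given the arrival times, the probability of a path is an explicit product,
  because following it means that each \<open>U\<^sub>q\<close> and each \<open>V\<^sub>i\<close> falls into a set determined by the
  path. On a path, the likelihood ratio is the quotient of the target and reference
  probabilities, and the states of the two processes coincide, so the identity holds path by path.
\<close>

section \<open>Thinning for fixed data\<close>

text \<open>Positivity of \<open>qt\<close> and the strict bounds on \<open>lamt\<^sub>0\<close>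
  make every factor of the reference weight nonzero. This is the absolute continuity behind the
  statement: the quotient never has a zero denominator, while a path that the target gives weight
  zero merely has ratio 0.

  The ratio can be unbounded, since long runs of rejections contribute high powers of quotients of
  rejection probabilities. Sums and integrals are therefore exchanged for nonnegative integrands in
  \<open>ennreal\<close>; integrability of the weighted side is then deduced from the bounded target
  side, and signed \<open>g\<close> are reached by adding a constant.

  The position is real valued and would spoil countability, so it is left out of the path and
  recovered from the path and the arrival times. The state and the ratio thus need to be measurable
  in the arrival times only, one fixed path at a time.\<close>

lemma Inf_enat_eq_enat_iff:
  "Inf {enat j | j. P j} = enat b \<longleftrightarrow> P b \<and> (\<forall>q<b. \<not> P q)"
proof
  assume *: "Inf {enat j | j. P j} = enat b"
  then have ne: "{enat j | j. P j} \<noteq> {}"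
    by (metis Inf_empty top_enat_def enat.distinct(1))
  with * have "enat b \<in> {enat j | j. P j}"
    by (metis (no_types, lifting) Inf_enat_def LeastI_ex ex_in_conv)
  moreover have "\<not> P q" if "q < b" for q
  proof
    assume "P q"
    then have "Inf {enat j | j. P j} \<le> enat q" by (intro Inf_lower) auto
    with * that show False by simp
  qed
  ultimately show "P b \<and> (\<forall>q<b. \<not> P q)" by auto
next
  assume *: "P b \<and> (\<forall>q<b. \<not> P q)"
  show "Inf {enat j | j. P j} = enat b"
  proof (rule antisym)
    show "Inf {enat j | j. P j} \<le> enat b" using * by (intro Inf_lower) auto
    show "enat b \<le> Inf {enat j | j. P j}"
      using * by (intro Inf_greatest) (auto simp: not_less[symmetric])
  qed
qed

text \<open>The empty set, with infimum \<infinity>, is included here. The stretch after the last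
  jump before time \<open>t\<close> is thus described without deciding whether another jump ever
  comes.\<close>

lemma less_Inf_enat_iff:
  "enat m < Inf {enat j | j. P j} \<longleftrightarrow> (\<forall>q\<le>m. \<not> P q)"
proof -
  have "enat m < Inf {enat j | j. P j} \<longleftrightarrow> enat (Suc m) \<le> Inf {enat j | j. P j}"
    by (simp only: Suc_ile_eq)
  also have "\<dots> \<longleftrightarrow> (\<forall>q\<le>m. \<not> P q)"
    by (auto simp: le_Inf_iff not_less_eq_eq)
  finally show ?thesis .
qed

section \<open>Thinning along a prescribed discrete path\<close>

primrec path_pos ::
  "('k \<Rightarrow> real \<Rightarrow> real \<Rightarrow> real) \<Rightarrow> real \<Rightarrow> (nat \<Rightarrow> real) \<Rightarrow> (nat \<Rightarrow> nat \<times> 'k) \<Rightarrow> nat \<Rightarrow> real" where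
  "path_pos \<Phi> \<nu> T p 0 = \<nu>"
| "path_pos \<Phi> \<nu> T p (Suc i) =
     \<Phi> (snd (p i)) (T (fst (p (Suc i))) - T (fst (p i))) (path_pos \<Phi> \<nu> T p i)"

declare path_pos.simps(2) [simp del]

text \<open>The thinning output along a discrete path \<open>p i = (\<tau>\<^sub>i, \<theta>\<^sub>i)\<close>: the positions are determined
  by \<open>p\<close> and the arrival times.\<close>

definition path_seq ::
  "('k \<Rightarrow> real \<Rightarrow> real \<Rightarrow> real) \<Rightarrow> real \<Rightarrow> (nat \<Rightarrow> real) \<Rightarrow> (nat \<Rightarrow> nat \<times> 'k) \<Rightarrow> nat \<Rightarrow> enat \<times> 'k \<times> real" where
  "path_seq \<Phi> \<nu> T p i = (enat (fst (p i)), snd (p i), path_pos \<Phi> \<nu> T p i)"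

lemma path_seq_simps [simp]:
  "tau (path_seq \<Phi> \<nu> T p) i = fst (p i)"
  "mode (path_seq \<Phi> \<nu> T p) i = snd (p i)"
  "pos (path_seq \<Phi> \<nu> T p) i = path_pos \<Phi> \<nu> T p i"
  by (simp_all add: tau_def mode_def pos_def path_seq_def)

declare thinning.simps(2) [simp del]

lemma thinning_Suc_eq_enat_iff:
  assumes "thinning l k I \<Phi> lam Q x T U V n = (enat a, \<theta>, \<nu>)"
  shows "thinning l k I \<Phi> lam Q x T U V (Suc n) = (enat b, \<theta>', \<nu>') \<longleftrightarrow>
    a < b \<and> (\<forall>q. a < q \<and> q < b \<longrightarrow> \<not> U q * l \<le> lam (\<theta>, \<Phi> \<theta> (T q - T a) \<nu>)) \<and>
    U b * l \<le> lam (\<theta>, \<Phi> \<theta> (T b - T a) \<nu>) \<and>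
    \<nu>' = \<Phi> \<theta> (T b - T a) \<nu> \<and> \<theta>' = select_mode k I Q (\<theta>, \<nu>') (V (Suc n))"
proof -
  let ?P = "\<lambda>j. a < j \<and> U j * l \<le> lam (\<theta>, \<Phi> \<theta> (T j - T a) \<nu>)"
  have "thinning l k I \<Phi> lam Q x T U V (Suc n) = (enat b, \<theta>', \<nu>') \<longleftrightarrow>
      Inf {enat j | j. ?P j} = enat b \<and>
      \<nu>' = \<Phi> \<theta> (T b - T a) \<nu> \<and> \<theta>' = select_mode k I Q (\<theta>, \<nu>') (V (Suc n))"
    using assms by (auto simp: thinning.simps(2) Let_def split: enat.splits)
  then show ?thesis unfolding Inf_enat_eq_enat_iff by blast
qed

lemma less_fst_thinning_Suc_iff:
  assumes "thinning l k I \<Phi> lam Q x T U V n = (enat a, \<theta>, \<nu>)"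
  shows "enat m < fst (thinning l k I \<Phi> lam Q x T U V (Suc n)) \<longleftrightarrow>
    (\<forall>q. a < q \<and> q \<le> m \<longrightarrow> \<not> U q * l \<le> lam (\<theta>, \<Phi> \<theta> (T q - T a) \<nu>))"
proof -
  let ?P = "\<lambda>j. a < j \<and> U j * l \<le> lam (\<theta>, \<Phi> \<theta> (T j - T a) \<nu>)"
  have "fst (thinning l k I \<Phi> lam Q x T U V (Suc n)) = Inf {enat j | j. ?P j}"
    using assms by (auto simp: thinning.simps(2) Let_def split: enat.splits)
  then show ?thesis using less_Inf_enat_iff[of m ?P] by auto
qed

lemma fst_thinning_Suc_infinity:
  assumes "fst (thinning l k I \<Phi> lam Q x T U V n) = \<infinity>"
  shows "fst (thinning l k I \<Phi> lam Q x T U V (Suc n)) = \<infinity>"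
proof -
  obtain \<theta> \<nu> where *: "thinning l k I \<Phi> lam Q x T U V n = (\<infinity>, \<theta>, \<nu>)"
    using assms by (metis prod.collapse)
  show ?thesis using * by (auto simp: thinning.simps(2) Let_def Inf_enat_def split: enat.splits)
qed

text \<open>Strict increase can fail only at \<infinity>, which is absorbing because no arrival
  index lies beyond it.\<close>

lemma thinning_jump_cases:
  "fst (thinning l k I \<Phi> lam Q x T U V (Suc n)) = \<infinity> \<or>
   fst (thinning l k I \<Phi> lam Q x T U V n) < fst (thinning l k I \<Phi> lam Q x T U V (Suc n))"
proof (cases "thinning l k I \<Phi> lam Q x T U V n")
  case (fields \<tau> \<theta> \<nu>)
  obtain \<tau>' \<theta>' \<nu>' where Suc: "thinning l k I \<Phi> lam Q x T U V (Suc n) = (\<tau>', \<theta>', \<nu>')"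
    by (rule prod_cases3)
  show ?thesis
  proof (cases \<tau>)
    case (enat a)
    show ?thesis
    proof (cases \<tau>')
      case (enat b)
      then have "a < b" using thinning_Suc_eq_enat_iff[of l k I \<Phi> lam Q x T U V n a \<theta> \<nu> b \<theta>' \<nu>']
          fields Suc \<open>\<tau> = enat a\<close> by blast
      then show ?thesis unfolding fields Suc using enat \<open>\<tau> = enat a\<close> by simp
    qed (simp add: Suc)
  next
    case infinity
    then show ?thesis using fields fst_thinning_Suc_infinity[of l k I \<Phi> lam Q x T U V n]
      by simp
  qed
qed

lemma mono_fst_thinning: "mono (\<lambda>i. fst (thinning l k I \<Phi> lam Q x T U V i))"
  unfolding mono_iff_le_Suc
  using thinning_jump_cases by (metis enat_ord_code(3) less_imp_le)

text \<open>Each jump consumes at least one arrival. This bounds the number of jumps by the number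
  of arrivals.\<close>

lemma enat_le_fst_thinning: "enat n \<le> fst (thinning l k I \<Phi> lam Q x T U V n)"
proof (induction n)
  case 0
  then show ?case by (simp add: zero_enat_def)
next
  case (Suc n)
  then show ?case
    using thinning_jump_cases[of l k I \<Phi> lam Q x T U V n]
    by (metis Suc_ile_eq enat_ord_code(3) le_less_trans)
qed

text \<open>Once the arrival times and \<open>p\<close> are fixed, the recursion decouples: the
  conditions on \<open>U\<close> do not mention \<open>V\<close> and conversely, which is what
  independence can act on. Agreement is carried along for all steps up to \<open>n\<close> because
  each step supplies the state from which the next one is computed.\<close>

lemma thinning_eq_path_seq_iff:
  "(\<forall>i\<le>n. thinning l k I \<Phi> lam Q x T U V i = path_seq \<Phi> (snd x) T p i) \<longleftrightarrow>
    p 0 = (0, fst x) \<and>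
    (\<forall>i<n. fst (p i) < fst (p (Suc i)) \<and>
      (\<forall>q. fst (p i) < q \<and> q < fst (p (Suc i)) \<longrightarrow> \<not> U q * l \<le> rate_at \<Phi> lam T (path_seq \<Phi> (snd x) T p) i q) \<and>
      U (fst (p (Suc i))) * l \<le> rate_at \<Phi> lam T (path_seq \<Phi> (snd x) T p) i (fst (p (Suc i))) \<and>
      select_mode k I Q (snd (p i), path_pos \<Phi> (snd x) T p (Suc i)) (V (Suc i)) = snd (p (Suc i)))"
proof (induction n)
  case 0
  show ?case by (cases x; cases "p 0") (auto simp: path_seq_def zero_enat_def)
next
  case (Suc n)
  let ?S = "thinning l k I \<Phi> lam Q x T U V"
  have "?S (Suc n) = path_seq \<Phi> (snd x) T p (Suc n) \<longleftrightarrow> 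
     fst (p n) < fst (p (Suc n)) \<and>
      (\<forall>q. fst (p n) < q \<and> q < fst (p (Suc n)) \<longrightarrow> \<not> U q * l \<le> rate_at \<Phi> lam T (path_seq \<Phi> (snd x) T p) n q) \<and>
      U (fst (p (Suc n))) * l \<le> rate_at \<Phi> lam T (path_seq \<Phi> (snd x) T p) n (fst (p (Suc n))) \<and>
      select_mode k I Q (snd (p n), path_pos \<Phi> (snd x) T p (Suc n)) (V (Suc n)) = snd (p (Suc n))"
    if "?S n = path_seq \<Phi> (snd x) T p n"
    using thinning_Suc_eq_enat_iff[of l k I \<Phi> lam Q x T U V n, OF that[unfolded path_seq_def]]
    by (auto simp: rate_at_def path_seq_def[of _ _ _ _ "Suc n"] path_pos.simps(2))
  with Suc.IH show ?case
    by (auto simp: le_Suc_eq less_Suc_eq)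
qed

section \<open>Jumps of one realisation up to a fixed time\<close>

text \<open>Here \<open>m\<close> stands for the number of arrivals up to \<open>t\<close>. The
  equivalence \<open>T_le_t_iff\<close> trades comparisons with the real number \<open>t\<close> for
  comparisons of arrival indices.\<close>

locale thinning_path =
  fixes l :: real and k :: "nat \<Rightarrow> 'k" and I :: "nat set"
    and \<Phi> :: "'k \<Rightarrow> real \<Rightarrow> real \<Rightarrow> real" and lam :: "'k \<times> real \<Rightarrow> real"
    and Q :: "'k \<times> real \<Rightarrow> ('k \<times> real) measure" and x :: "'k \<times> real"
    and T U V :: "nat \<Rightarrow> real" and t :: real and m :: nat
  assumes strict_mono_T: "strict_mono T"
    and T_le_t_iff: "\<And>j. T j \<le> t \<longleftrightarrow> j \<le> m"
begin

abbreviation S where "S \<equiv> thinning l k I \<Phi> lam Q x T U V"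

abbreviation ps where "ps \<equiv> path_seq \<Phi> (snd x) T"

lemma jump_time_le_iff: "jump_time T S i \<le> ereal t \<longleftrightarrow> fst (S i) \<le> enat m"
  by (cases "fst (S i)") (simp_all add: jump_time_def T_le_t_iff)

text \<open>The jump indices are monotone, so the jumps counted form an initial segment {1..c}, and
  \<open>c\<close> is the place where the indices pass \<open>m\<close>.\<close>

lemma jump_count_eq_iff:
  "jump_count T S t = n \<longleftrightarrow> fst (S n) \<le> enat m \<and> enat m < fst (S (Suc n))"
proof -
  let ?A = "{i. 1 \<le> i \<and> fst (S i) \<le> enat m}"
  have *: "jump_count T S t = c" if "fst (S c) \<le> enat m" "enat m < fst (S (Suc c))" for c
  proof -
    have "fst (S i) \<le> enat m \<longleftrightarrow> i \<le> c" for i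
    proof
      assume "fst (S i) \<le> enat m"
      then have "\<not> fst (S (Suc c)) \<le> fst (S i)" using that(2) by simp
      then have "\<not> Suc c \<le> i" using monoD[OF mono_fst_thinning] by blast
      then show "i \<le> c" by simp
    next
      assume "i \<le> c"
      from monoD[OF mono_fst_thinning this] that(1) show "fst (S i) \<le> enat m"
        by (rule order.trans)
    qed
    then have "?A = {1..c}"
      unfolding set_eq_iff mem_Collect_eq atLeastAtMost_iff by blast
    then have "card ?A = c" by simp
    then show ?thesis unfolding jump_count_def jump_time_le_iff .
  qed
  obtain c where c: "fst (S c) \<le> enat m" "enat m < fst (S (Suc c))"
  proof -
    define c where "c = (LEAST i. enat m < fst (S (Suc i)))"
    \<comment> \<open>This makes the set defining \<open>c\<close> nonempty: jump
      \<open>m + 1\<close> cannot occur before arrival \<open>m + 1\<close>.\<close>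
    have "enat m < fst (S (Suc m))" using enat_le_fst_thinning[of "Suc m"] Suc_ile_eq by blast
    then have 1: "enat m < fst (S (Suc c))" unfolding c_def by (rule LeastI)
    have "fst (S c) \<le> enat m"
    proof (cases c)
      case (Suc i)
      have "\<not> enat m < fst (S (Suc i))"
        by (rule not_less_Least[of i "\<lambda>i. enat m < fst (S (Suc i))", folded c_def]) (simp add: Suc)
      then show ?thesis unfolding Suc by (simp only: not_less)
    qed (simp add: zero_enat_def[symmetric])
    from that[OF this 1] show thesis .
  qed
  then have "jump_count T S t = c" by (rule *)
  with c * show ?thesis by blast
qed

lemma pdp_eq:
  assumes "jump_count T S t = n"
  shows "pdp \<Phi> x T S t = (if t = 0 then x else
    (mode S n, \<Phi> (mode S n) (t - T (tau S n)) (pos S n)))"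
proof -
  have "(THE n. jump_time T S n \<le> ereal t \<and> ereal t < jump_time T S (Suc n)) = n"
  proof (rule the_equality)
    show "jump_time T S n \<le> ereal t \<and> ereal t < jump_time T S (Suc n)"
      using assms by (simp add: jump_time_le_iff jump_count_eq_iff not_le[symmetric])
    fix n' assume "jump_time T S n' \<le> ereal t \<and> ereal t < jump_time T S (Suc n')"
    then have "jump_count T S t = n'"
      by (simp add: jump_time_le_iff jump_count_eq_iff not_le[symmetric])
    with assms show "n' = n" by simp
  qed
  then show ?thesis by (simp add: pdp_def Let_def)
qed

lemma fst_thinning_eq_tau:
  assumes "jump_count T S t = n" "i \<le> n"
  shows "fst (S i) = enat (tau S i)" "tau S i \<le> m"
proof -
  have "fst (S i) \<le> enat m"
    using assms monoD[OF mono_fst_thinning assms(2), of l k I \<Phi> lam Q x T U V]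
    unfolding jump_count_eq_iff by (metis order.trans)
  then show "fst (S i) = enat (tau S i)" "tau S i \<le> m"
    unfolding tau_def by (cases "fst (S i)"; simp)+
qed

lemma tau_less_tau_Suc:
  assumes "jump_count T S t = n" "i < n"
  shows "tau S i < tau S (Suc i)"
  using thinning_jump_cases[of l k I \<Phi> lam Q x T U V i]
    fst_thinning_eq_tau(1)[OF assms(1), of i] fst_thinning_eq_tau(1)[OF assms(1), of "Suc i"] assms(2)
  by simp

text \<open>Extensionality fixes \<open>p\<close> beyond \<open>n\<close>, so that one trace
  corresponds to one path. A trace records no positions, yet the recursion forces them: each is
  obtained from the previous one by the flow between two jump times.\<close>

lemma jump_count_trace_iff:
  assumes "p \<in> extensional {..n}"
  shows "jump_count T S t = n \<and> restrict (\<lambda>i. (tau S i, mode S i)) {..n} = p \<longleftrightarrow>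
    (\<forall>i\<le>n. S i = ps p i) \<and> fst (p n) \<le> m \<and>
    (\<forall>q. fst (p n) < q \<and> q \<le> m \<longrightarrow> \<not> U q * l \<le> rate_at \<Phi> lam T (ps p) n q)"
proof -
  have *: "jump_count T S t = n \<longleftrightarrow> fst (p n) \<le> m \<and>
    (\<forall>q. fst (p n) < q \<and> q \<le> m \<longrightarrow> \<not> U q * l \<le> rate_at \<Phi> lam T (ps p) n q)"
    if "S n = ps p n"
    unfolding jump_count_eq_iff
    using less_fst_thinning_Suc_iff[of l k I \<Phi> lam Q x T U V n, OF that[unfolded path_seq_def]] that
    by (auto simp: rate_at_def path_seq_def)
  have 2: "restrict (\<lambda>i. (tau S i, mode S i)) {..n} = p" if "\<forall>i\<le>n. S i = ps p i"
  proof (rule extensionalityI[OF _ assms])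
    fix i assume "i \<in> {..n}"
    then show "restrict (\<lambda>i. (tau S i, mode S i)) {..n} i = p i"
      using that by (simp add: tau_def mode_def path_seq_def)
  qed simp
  have 3: "\<forall>i\<le>n. S i = ps p i"
    if 31: "jump_count T S t = n" and 32: "restrict (\<lambda>i. (tau S i, mode S i)) {..n} = p"
  proof safe
    fix i assume "i \<le> n"
    then show "S i = ps p i"
    proof (induction i)
      case 0
      then show ?case using 32
        by (auto simp: path_seq_def tau_def mode_def zero_enat_def)
    next
      case (Suc i)
      have pSuc: "p (Suc i) = (tau S (Suc i), mode S (Suc i))" using 32 Suc.prems by auto
      have f: "S (Suc i) = (enat (tau S (Suc i)), mode S (Suc i), pos S (Suc i))"
        using fst_thinning_eq_tau(1)[OF 31 Suc.prems]
        by (simp add: mode_def pos_def prod_eq_iff)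
      have "S i = ps p i" using Suc by simp
      \<comment> \<open>The jump observed in \<open>f\<close> is read backwards through the step
        lemma, which returns the missing equation for the position.\<close>
      from iffD1[OF thinning_Suc_eq_enat_iff[of l k I \<Phi> lam Q x T U V i, OF this[unfolded path_seq_def]] f]
      show ?case unfolding f by (simp add: path_seq_def pSuc path_pos.simps(2))
    qed
  qed
  show ?thesis using * 2 3 by blast
qed

end

section \<open>Mode selection\<close>

abbreviation unif01 :: "real measure" where "unif01 \<equiv> uniform_measure lborel {0..1}"

lemma prob_space_unif01: "prob_space unif01"
  by (rule prob_space_uniform_measure) auto

lemma measure_unif01_atMost:
  assumes "0 \<le> r" "r \<le> 1" shows "measure unif01 {..r} = r"
proof -
  have "{0..1} \<inter> {..r} = {0..r}" using assms by auto
  then show ?thesis using assms by simp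
qed

text \<open>With \<open>c\<close> a jump rate and \<open>l\<close> the Poisson intensity, these are
  the acceptance and rejection probabilities of an arrival; \<open>c \<le> l\<close> keeps
  \<open>c / l\<close> inside [0, 1], where the uniform distribution function is the
  identity.\<close>

lemma measure_unif01_le:
  assumes "0 < l" "0 \<le> c" "c \<le> l"
  shows "measure unif01 {u. u * l \<le> c} = c / l" "measure unif01 {u. \<not> u * l \<le> c} = 1 - c / l"
proof -
  interpret prob_space unif01 by (rule prob_space_unif01)
  have *: "{u. u * l \<le> c} = {..c / l}" using assms by (auto simp: field_simps)
  then show 1: "prob {u. u * l \<le> c} = c / l"
    using measure_unif01_atMost[of "c / l"] assms by simp
  have "{u. \<not> u * l \<le> c} = space unif01 - {u. u * l \<le> c}" by auto
  then show "prob {u. \<not> u * l \<le> c} = 1 - c / l"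
    using prob_compl[of "{u. u * l \<le> c}"] 1 by (simp add: *)
qed

lemma measure_unif01_greaterThanAtMost:
  assumes "0 \<le> a" "a \<le> b" "b \<le> 1" shows "measure unif01 {a<..b} = b - a"
proof -
  have "{0..1} \<inter> {a<..b} = {a<..b}" using assms by auto
  then show ?thesis using assms by simp
qed

text \<open>The excluded endpoints are the only values in [0, 1] at which mode selection can be
  unspecified: 0 always, 1 if the partial sums do not reach 1.\<close>

lemma AE_unif01: "AE v in unif01. 0 < v \<and> v < 1"
proof (rule AE_uniform_measureI)
  have "AE v in lborel. v \<noteq> (0::real)" "AE v in lborel. v \<noteq> (1::real)"
    by (rule AE_lborel_singleton)+
  then show "AE v in lborel. v \<in> {0..1} \<longrightarrow> 0 < v \<and> v < (1::real)"
    by eventually_elim auto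
qed simp

section \<open>Cumulative mode probabilities\<close>

abbreviation cum_prob :: "(nat \<Rightarrow> 'k) \<Rightarrow> ('k \<times> real \<Rightarrow> ('k \<times> real) measure) \<Rightarrow> 'k \<times> real \<Rightarrow> nat \<Rightarrow> real" where
  "cum_prob k Q y j \<equiv> \<Sum>i = 1..j. mode_prob Q y {k i}"

lemma mode_prob_nonneg: "0 \<le> mode_prob Q y A"
  by (simp add: mode_prob_def)

lemma mono_cum_prob: "i \<le> j \<Longrightarrow> cum_prob k Q y i \<le> cum_prob k Q y j"
  by (rule sum_mono2) (auto simp: mode_prob_nonneg)

lemma enumeration_downward: "enumeration k I \<Longrightarrow> i \<in> I \<Longrightarrow> {1..i} \<subseteq> I"
  by (auto simp: enumeration_def)

lemma enumeration_ge_1: "enumeration k I \<Longrightarrow> i \<in> I \<Longrightarrow> 1 \<le> i"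
  by (auto simp: enumeration_def)

lemma enumeration_countable:
  fixes k :: "nat \<Rightarrow> 'k"
  assumes "enumeration k I" shows "countable (UNIV :: 'k set)"
proof -
  have "k ` I = UNIV" using assms by (simp add: enumeration_def bij_betw_def)
  moreover have "countable (k ` I)" by (intro countable_image countableI_type)
  ultimately show ?thesis by simp
qed

lemma enumeration_surj:
  assumes "enumeration k I" obtains i where "i \<in> I" "\<theta> = k i"
proof -
  have "\<theta> \<in> k ` I" using assms by (simp add: enumeration_def bij_betw_def)
  with that show thesis by blast
qed

lemma enumeration_inj_on: "enumeration k I \<Longrightarrow> inj_on k I"
  by (simp add: enumeration_def bij_betw_def)

text \<open>Monotone partial sums make the intervals with distinct indices disjoint, so the
  description under THE has one solution.\<close>

lemma select_mode_eq:
  assumes "i \<in> I" "cum_prob k Q y (i - 1) < v" "v \<le> cum_prob k Q y i" "enumeration k I"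
  shows "select_mode k I Q y v = k i"
proof -
  have "i' = i" if "i' \<in> I" "cum_prob k Q y (i' - 1) < v" "v \<le> cum_prob k Q y i'" for i'
  proof (rule ccontr)
    assume "i' \<noteq> i"
    then consider "i' \<le> i - 1" | "i \<le> i' - 1" by linarith
    then show False
      by cases (use mono_cum_prob[of i' "i - 1" Q y k] mono_cum_prob[of i "i' - 1" Q y k] that assms in linarith)+
  qed
  then have "(THE i. i \<in> I \<and> cum_prob k Q y (i - 1) < v \<and> v \<le> cum_prob k Q y i) = i"
    by (intro the_equality) (use assms in blast)+
  then show ?thesis unfolding select_mode_def Let_def by (rule arg_cong)
qed

text \<open>The second disjunct describes the unspecified mode: it is selected with probability zero, but the
  events must be measurable everywhere.\<close>

lemma select_mode_eq_iff:
  assumes "enumeration k I" "i \<in> I"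
  shows "select_mode k I Q y v = k i \<longleftrightarrow>
    cum_prob k Q y (i - 1) < v \<and> v \<le> cum_prob k Q y i \<or>
    (\<forall>j\<in>I. \<not> (cum_prob k Q y (j - 1) < v \<and> v \<le> cum_prob k Q y j)) \<and> k (THE i. False) = k i"
proof (cases "\<exists>j\<in>I. cum_prob k Q y (j - 1) < v \<and> v \<le> cum_prob k Q y j")
  case True
  then obtain j where j: "j \<in> I" "cum_prob k Q y (j - 1) < v" "v \<le> cum_prob k Q y j" by blast
  have "k j = k i \<longleftrightarrow> j = i" using j(1) assms(2) enumeration_inj_on[OF assms(1)] by (auto dest: inj_onD)
  then show ?thesis
    using select_mode_eq[OF j assms(1)] select_mode_eq[OF assms(2) _ _ assms(1), of Q y v] j True by auto
next
  case False
  \<comment> \<open>All unsatisfiable descriptions are the same predicate, so the unspecified index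
    does not vary with \<open>y\<close> or \<open>v\<close>.\<close>
  then have "(\<lambda>i. i \<in> I \<and> cum_prob k Q y (i - 1) < v \<and> v \<le> cum_prob k Q y i) = (\<lambda>i. False)"
    by auto
  then have "select_mode k I Q y v = k (THE i. False)" unfolding select_mode_def Let_def by simp
  then show ?thesis using False assms(2) by auto
qed

lemma pdp_kernel:
  assumes "pdp_characteristics \<Phi> lam Q"
  shows "prob_space (Q y)" "sets (Q y) = sets state_space"
proof -
  have "Q y \<in> space (prob_algebra state_space)"
    using assms by (auto simp: pdp_characteristics_def state_space_def space_pair_measure dest: measurable_space)
  then show "prob_space (Q y)" "sets (Q y) = sets state_space"
    by (auto simp: space_prob_algebra)
qed

lemma sum_mode_prob:
  assumes "pdp_characteristics \<Phi> lam Q" "inj_on k J" "finite J"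
  shows "(\<Sum>i\<in>J. mode_prob Q y {k i}) = mode_prob Q y (k ` J)"
proof -
  note Q = pdp_kernel[OF assms(1), of y]
  interpret prob_space "Q y" by (rule Q(1))
  have "prob (\<Union>i\<in>J. {k i} \<times> UNIV) = (\<Sum>i\<in>J. prob ({k i} \<times> UNIV))"
    using assms Q(2)
    by (intro finite_measure_finite_Union) (auto simp: disjoint_family_on_def state_space_def dest: inj_onD)
  moreover have "(\<Union>i\<in>J. {k i} \<times> UNIV) = k ` J \<times> (UNIV :: real set)" by auto
  ultimately show ?thesis by (simp add: mode_prob_def)
qed

lemma mode_prob_UNIV:
  assumes "pdp_characteristics \<Phi> lam Q"
  shows "mode_prob Q y A \<le> 1" "mode_prob Q y UNIV = 1"
proof -
  note Q = pdp_kernel[OF assms(1), of y]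
  interpret prob_space "Q y" by (rule Q(1))
  show "mode_prob Q y A \<le> 1" by (simp add: mode_prob_def)
  have "UNIV \<times> UNIV = space (Q y)"
    using sets_eq_imp_space_eq[OF Q(2)] by (simp add: state_space_def space_pair_measure)
  then show "mode_prob Q y UNIV = 1" by (simp only: mode_prob_def prob_space)
qed

text \<open>The first \<open>i\<close> modes increase to the whole mode set; continuity from below
  of the kernel gives the limit.\<close>

lemma cum_prob_tendsto_1:
  assumes "pdp_characteristics \<Phi> lam Q" "bij_betw k {1..} UNIV"
  shows "cum_prob k Q y \<longlonglongrightarrow> 1"
proof -
  note Q = pdp_kernel[OF assms(1), of y]
  interpret prob_space "Q y" by (rule Q(1))
  have inj: "inj_on k {1..}" and surj: "k ` {1..} = UNIV" using assms(2) by (auto simp: bij_betw_def)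
  have "(\<lambda>i. prob (k ` {1..i} \<times> UNIV)) \<longlonglongrightarrow> prob (\<Union>i. k ` {1..i} \<times> UNIV)"
  proof (rule finite_Lim_measure_incseq)
    have "A \<times> UNIV \<in> sets (Q y)" for A by (simp add: Q(2) state_space_def)
    then show "range (\<lambda>i. k ` {1..i} \<times> UNIV) \<subseteq> sets (Q y)" by blast
    show "incseq (\<lambda>i. k ` {1..i} \<times> (UNIV :: real set))"
      by (intro incseq_SucI Sigma_mono image_mono) auto
  qed
  moreover have "(\<Union>i. k ` {1..i} \<times> UNIV) = UNIV \<times> (UNIV :: real set)"
  proof -
    have "\<exists>i. a \<in> k ` {1..i}" for a
    proof -
      obtain i where "1 \<le> i" "a = k i" using surj by (metis UNIV_I atLeast_iff imageE)
      then show ?thesis by (intro exI[of _ i]) auto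
    qed
    then show ?thesis by blast
  qed
  moreover have "prob (k ` {1..i} \<times> UNIV) = cum_prob k Q y i" for i
    using sum_mode_prob[OF assms(1) inj_on_subset[OF inj], of "{1..i}" y] by (auto simp: mode_prob_def)
  ultimately show ?thesis using mode_prob_UNIV(2)[OF assms(1), of y] by (simp add: mode_prob_def)
qed

lemma cum_prob_le_1:
  assumes "pdp_characteristics \<Phi> lam Q" "enumeration k I" "i \<in> I"
  shows "cum_prob k Q y i \<le> 1"
proof -
  have "inj_on k {1..i}"
    by (rule inj_on_subset[OF enumeration_inj_on[OF assms(2)] enumeration_downward[OF assms(2,3)]])
  then show ?thesis using sum_mode_prob[OF assms(1), of k "{1..i}" y] mode_prob_UNIV(1)[OF assms(1)] by simp
qed

text \<open>The witness is the first index whose partial sum reaches \<open>v\<close>; one exists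
  because the sums reach or approach 1, and \<open>v < 1\<close>.\<close>

lemma ex_cum_prob:
  assumes "pdp_characteristics \<Phi> lam Q" "enumeration k I" "0 < v" "v < 1"
  shows "\<exists>i\<in>I. cum_prob k Q y (i - 1) < v \<and> v \<le> cum_prob k Q y i"
proof -
  obtain j where j: "v \<le> cum_prob k Q y j" "j \<in> insert 0 I"
  proof (cases "I = {1..}")
    case True
    then have "cum_prob k Q y \<longlonglongrightarrow> 1"
      using assms(2) cum_prob_tendsto_1[OF assms(1)] by (simp add: enumeration_def)
    from order_tendstoD(1)[OF this assms(4)] obtain j where "v < cum_prob k Q y j"
      by (auto simp: eventually_sequentially)
    then show ?thesis using that[of j] True by fastforce
  next
    case False
    then obtain j where j: "I = {1..j}" "inj_on k {1..j}" "k ` {1..j} = UNIV"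
      using assms(2) by (auto simp: enumeration_def bij_betw_def)
    then have "cum_prob k Q y j = 1"
      using sum_mode_prob[OF assms(1) j(2)] mode_prob_UNIV(2)[OF assms(1)] by simp
    then show ?thesis using that[of j] assms(4) j(1) by fastforce
  qed
  define i where "i = (LEAST i. v \<le> cum_prob k Q y i)"
  have 1: "v \<le> cum_prob k Q y i" unfolding i_def using j(1) by (rule LeastI)
  have "i \<noteq> 0"
  proof
    assume "i = 0" with 1 assms(3) show False by simp
  qed
  moreover have "i \<le> j" unfolding i_def by (rule Least_le) (rule j(1))
  ultimately have "i \<in> I" using j(2) enumeration_downward[OF assms(2), of j] by auto
  moreover have "cum_prob k Q y (i - 1) < v"
    using not_less_Least[of "i - 1" "\<lambda>i. v \<le> cum_prob k Q y i", folded i_def] \<open>i \<noteq> 0\<close>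
    by simp
  ultimately show ?thesis using 1 by blast
qed

text \<open>Away from a null set the selection event is an interval whose length is an increment of
  the partial sums.\<close>

lemma measure_select_mode:
  assumes "pdp_characteristics \<Phi> lam Q" "enumeration k I"
    and meas: "{v. select_mode k I Q y v = \<theta>} \<in> sets borel"
  shows "measure unif01 {v. select_mode k I Q y v = \<theta>} = mode_prob Q y {\<theta>}"
proof -
  obtain i where i: "i \<in> I" "\<theta> = k i"
    using enumeration_surj[OF assms(2), of \<theta>] by blast
  have "1 \<le> i" using enumeration_ge_1[OF assms(2) i(1)] .
  then have Suc: "cum_prob k Q y i = cum_prob k Q y (i - 1) + mode_prob Q y {k i}"
    by (cases i) auto
  have "AE v in unif01. v \<in> {v. select_mode k I Q y v = \<theta>} \<longleftrightarrow> v \<in> {cum_prob k Q y (i - 1)<..cum_prob k Q y i}"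
    using AE_unif01
  proof eventually_elim
    case (elim v)
    then show ?case
      using select_mode_eq_iff[OF assms(2) i(1), of Q y v] ex_cum_prob[OF assms(1,2), of v y] i(2) by auto
  qed
  then have "measure unif01 {v. select_mode k I Q y v = \<theta>} =
      measure unif01 {cum_prob k Q y (i - 1)<..cum_prob k Q y i}"
    using meas by (intro measure_eq_AE) auto
  also have "\<dots> = mode_prob Q y {\<theta>}"
    using Suc cum_prob_le_1[OF assms(1,2) i(1), of y] i(2) mode_prob_nonneg[of Q y "{k i}"]
    by (subst measure_unif01_greaterThanAtMost) (auto intro!: sum_nonneg simp: mode_prob_nonneg)
  finally show ?thesis .
qed

lemma mode_prob_measurable:
  assumes "pdp_characteristics \<Phi> lam Q"
  shows "(\<lambda>y. mode_prob Q y A) \<in> borel_measurable state_space"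
proof -
  have "Q \<in> state_space \<rightarrow>\<^sub>M subprob_algebra state_space"
    using assms by (auto simp: pdp_characteristics_def intro: measurable_prob_algebraD)
  moreover have "A \<times> UNIV \<in> sets (state_space :: ('k \<times> real) measure)" for A :: "'k set"
    by (simp add: state_space_def)
  ultimately show ?thesis unfolding mode_prob_def
    by (rule measurable_compose[OF _ measurable_measure_subprob_algebra])
qed

lemma select_mode_measurable:
  assumes "pdp_characteristics \<Phi> lam Q" "enumeration k I"
    and f [measurable]: "f \<in> M \<rightarrow>\<^sub>M state_space" and h [measurable]: "h \<in> borel_measurable M"
  shows "Measurable.pred M (\<lambda>a. select_mode k I Q (f a) (h a) = \<theta>)"
proof -
  obtain i where i: "i \<in> I" "\<theta> = k i"
    using enumeration_surj[OF assms(2), of \<theta>] by blast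
  have [measurable]: "(\<lambda>a. mode_prob Q (f a) A) \<in> borel_measurable M" for A
    by (rule measurable_compose[OF f mode_prob_measurable[OF assms(1)]])
  show ?thesis unfolding i(2) select_mode_eq_iff[OF assms(2) i(1)] by measurable
qed

section \<open>Iterated integrals of three independent variables\<close>

text \<open>Independence turns the joint law into a product measure, and Tonelli splits the
  integral. The order suits the application: arrivals outermost, so that \<open>U\<close> and
  \<open>V\<close> are integrated with the arrival times fixed.\<close>

lemma (in prob_space) nn_integral_indep_vars_3:
  assumes indep: "indep_vars (\<lambda>_. N) X {..<3::nat}"
    and f: "(\<lambda>(a, b, c). f a b c) \<in> borel_measurable (N \<Otimes>\<^sub>M N \<Otimes>\<^sub>M N)"
  shows "(\<integral>\<^sup>+\<omega>. f (X 0 \<omega>) (X 1 \<omega>) (X 2 \<omega>) \<partial>M) =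
    (\<integral>\<^sup>+a. \<integral>\<^sup>+b. \<integral>\<^sup>+c. f a b c \<partial>distr M N (X 2) \<partial>distr M N (X 1) \<partial>distr M N (X 0))"
proof -
  have rv: "X i \<in> M \<rightarrow>\<^sub>M N" if "i < 3" for i
    using indep that by (auto simp: indep_vars_def)
  \<comment> \<open>The product locale wants a measure at every natural index; indices from 3 on get
    a copy of the law of \<open>X 0\<close>.\<close>
  define D where "D i = distr M N (X (if i < 3 then i else 0))" for i
  have D: "prob_space (D i)" for i
    unfolding D_def using rv by (intro prob_space_distr) auto
  have sets_D [measurable_cong]: "sets (D i) = sets N" for i by (simp add: D_def)
  interpret P0: prob_space "D 0" by (rule D)
  interpret P1: prob_space "D 1" by (rule D)
  interpret P2: prob_space "D 2" by (rule D)
  interpret product_sigma_finite D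
    using D by (auto simp: product_sigma_finite_def intro: prob_space_imp_sigma_finite)
  have f' [measurable]: "(\<lambda>(a, b, c). f a b c) \<in> borel_measurable (D 0 \<Otimes>\<^sub>M D 1 \<Otimes>\<^sub>M D 2)"
    using f by (simp cong: measurable_cong_sets add: sets_D)
  have m3: "(\<lambda>y. f (y 0) (y 1) (y 2)) \<in> borel_measurable (PiM {..<3} D)"
  proof -
    have "(\<lambda>y. (y 0, y 1, y 2)) \<in> PiM {..<3::nat} D \<rightarrow>\<^sub>M D 0 \<Otimes>\<^sub>M D 1 \<Otimes>\<^sub>M D 2" by measurable
    from measurable_compose[OF this f'] show ?thesis by simp
  qed
  have 3: "{..<3::nat} = insert 2 {0, 1}" by auto
  have "(\<integral>\<^sup>+\<omega>. f (X 0 \<omega>) (X 1 \<omega>) (X 2 \<omega>) \<partial>M) =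
      (\<integral>\<^sup>+y. f (y 0) (y 1) (y 2) \<partial>distr M (\<Pi>\<^sub>M i\<in>{..<3}. N) (\<lambda>\<omega>. \<lambda>i\<in>{..<3}. X i \<omega>))"
    using rv m3
    by (subst nn_integral_distr)
       (auto intro!: measurable_restrict nn_integral_cong simp: sets_D cong: measurable_cong_sets sets_PiM_cong)
  also have "distr M (\<Pi>\<^sub>M i\<in>{..<3}. N) (\<lambda>\<omega>. \<lambda>i\<in>{..<3}. X i \<omega>) = PiM {..<3} D"
  proof -
    have "distr M (\<Pi>\<^sub>M i\<in>{..<3}. N) (\<lambda>\<omega>. \<lambda>i\<in>{..<3}. X i \<omega>) = (\<Pi>\<^sub>M i\<in>{..<3}. distr M N (X i))"
      using indep_vars_iff_distr_eq_PiM'[where M' = "\<lambda>_. N" and X = X and I = "{..<3}"] indep rv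
      by (auto simp: lessThan_empty_iff)
    also have "\<dots> = PiM {..<3} D" by (auto simp: D_def intro!: PiM_cong)
    finally show ?thesis .
  qed
  also have "(\<integral>\<^sup>+y. f (y 0) (y 1) (y 2) \<partial>PiM {..<3} D) =
      (\<integral>\<^sup>+y. \<integral>\<^sup>+c. f (y 0) (y 1) c \<partial>D 2 \<partial>PiM {0, 1} D)"
    using m3 unfolding 3 by (subst product_nn_integral_insert) auto
  also have "\<dots> = (\<integral>\<^sup>+a. \<integral>\<^sup>+b. \<integral>\<^sup>+c. f a b c \<partial>D 2 \<partial>D 1 \<partial>D 0)"
  proof -
    let ?g = "\<lambda>a b. \<integral>\<^sup>+c. f a b c \<partial>D 2"
    have "(\<lambda>z. (fst (fst z), snd (fst z), snd z)) \<in> (D 0 \<Otimes>\<^sub>M D 1) \<Otimes>\<^sub>M D 2 \<rightarrow>\<^sub>M D 0 \<Otimes>\<^sub>M D 1 \<Otimes>\<^sub>M D 2"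
      by measurable
    from measurable_compose[OF this f']
    have "(\<lambda>(z, c). f (fst z) (snd z) c) \<in> borel_measurable ((D 0 \<Otimes>\<^sub>M D 1) \<Otimes>\<^sub>M D 2)"
      by (simp add: case_prod_beta)
    from P2.borel_measurable_nn_integral_fst[OF this]
    have g: "case_prod ?g \<in> borel_measurable (D 0 \<Otimes>\<^sub>M D 1)" by (simp add: case_prod_beta)
    have "(\<integral>\<^sup>+y. ?g (y 0) (y 1) \<partial>PiM {0, 1} D) = (\<integral>\<^sup>+z. ?g (fst z) (snd z) \<partial>(D 0 \<Otimes>\<^sub>M D 1))"
      by (rule product_nn_integral_pair[OF g]) simp
    also have "\<dots> = (\<integral>\<^sup>+a. \<integral>\<^sup>+b. ?g a b \<partial>D 1 \<partial>D 0)"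
      using P1.nn_integral_fst[OF g] by (simp add: case_prod_unfold)
    finally show ?thesis .
  qed
  finally show ?thesis by (simp add: D_def)
qed

section \<open>Weights of discrete paths\<close>

text \<open>The probability, given the arrival times, that the thinning follows \<open>p\<close> and rejects all
  arrivals between the \<open>n\<close>-th jump and \<open>m\<close>.\<close>

definition path_weight ::
  "real \<Rightarrow> ('k \<Rightarrow> real \<Rightarrow> real \<Rightarrow> real) \<Rightarrow> ('k \<times> real \<Rightarrow> real) \<Rightarrow> ('k \<times> real \<Rightarrow> ('k \<times> real) measure) \<Rightarrow>
   real \<Rightarrow> (nat \<Rightarrow> real) \<Rightarrow> nat \<Rightarrow> nat \<Rightarrow> (nat \<Rightarrow> nat \<times> 'k) \<Rightarrow> real" where
  "path_weight l \<Phi> lam Q \<nu> T n m p = (let r = rate_at \<Phi> lam T (path_seq \<Phi> \<nu> T p) in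
     (\<Prod>i<n. (\<Prod>q = fst (p i) + 1..fst (p (Suc i)) - 1. 1 - r i q / l) * (r i (fst (p (Suc i))) / l)) *
     (\<Prod>q = fst (p n) + 1..m. 1 - r n q / l) *
     (\<Prod>i<n. mode_prob Q (snd (p i), path_pos \<Phi> \<nu> T p (Suc i)) {snd (p (Suc i))}))"

text \<open>The convention that the factor at index 0 is 1 lets the product be shifted by one; the
  factors are then indexed by transitions, as in \<open>path_weight\<close>.\<close>

lemma prod_kappa: "kappa Q qt S n * (\<Prod>i<n. kappa Q qt S i) = (\<Prod>i<n. kappa Q qt S (Suc i))"
proof -
  have "kappa Q qt S n * (\<Prod>i<n. kappa Q qt S i) = (\<Prod>i<Suc n. kappa Q qt S i)"
    by (simp add: mult.commute)
  also have "\<dots> = (\<Prod>i<n. kappa Q qt S (Suc i))"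
    by (subst prod.lessThan_Suc_shift) (simp add: kappa_def)
  finally show ?thesis .
qed

text \<open>Each \<open>Z\<close> factor is a target factor over a reference factor, so the
  reference weight cancels term by term; the sign conditions make all denominators nonzero.\<close>

lemma likelihood_ratio_path_weight:
  assumes "\<And>\<theta> \<nu>. lamt (\<theta>, \<nu>) = lamt0 \<theta>"
    and "\<And>\<theta> \<nu> \<theta>'. mode_prob Qt (\<theta>, \<nu>) {\<theta>'} = qt \<theta> \<theta>'"
    and "\<And>\<theta> \<theta>'. 0 < qt \<theta> \<theta>'"
    and "\<And>\<theta>. 0 < lamt0 \<theta> \<and> lamt0 \<theta> < l"
  shows "likelihood_ratio l \<Phi> lam Q lamt0 qt T m (path_seq \<Phi> \<nu> T p) n * path_weight l \<Phi> lamt Qt \<nu> T n m p =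
    path_weight l \<Phi> lam Q \<nu> T n m p"
proof -
  let ?s = "path_seq \<Phi> \<nu> T p"
  define r where "r = rate_at \<Phi> lam T ?s"
  define d where "d i = lamt0 (snd (p i)) / l" for i
  define a where "a i = d i * (1 - d i) ^ (fst (p (Suc i)) - fst (p i) - 1)" for i
  define A where "A = (1 - d n) ^ (m - fst (p n))"
  define b where "b i = (r i (fst (p (Suc i))) / l) * (\<Prod>q = fst (p i) + 1..fst (p (Suc i)) - 1. 1 - r i q / l)" for i
  define B where "B = (\<Prod>q = fst (p n) + 1..m. 1 - r n q / l)"
  define c where "c i = mode_prob Q (snd (p i), path_pos \<Phi> \<nu> T p (Suc i)) {snd (p (Suc i))}" for i
  define e where "e i = qt (snd (p i)) (snd (p (Suc i)))" for i
  have "l > 0" using assms(4) by (meson less_trans)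
  then have d: "0 < d i" "d i < 1" for i using assms(4)[of "snd (p i)"] by (auto simp: d_def)
  have ne: "a i \<noteq> 0" "A \<noteq> 0" "e i \<noteq> 0" for i
    using d[of i] d[of n] assms(3)[of "snd (p i)" "snd (p (Suc i))"] by (auto simp: a_def A_def e_def)
  have inner: "Z_inner l \<Phi> lam Q lamt0 qt T ?s i = kappa Q qt ?s i * (inverse (a i) * b i)" for i
    by (simp add: Z_inner_def a_def b_def d_def r_def mult_ac)
  have last: "Z_last l \<Phi> lam Q lamt0 qt T m ?s n = kappa Q qt ?s n * (inverse A * B)"
    by (simp add: Z_last_def A_def B_def d_def r_def mult_ac)
  have kap: "kappa Q qt ?s (Suc i) = c i / e i" for i
    by (simp add: kappa_def c_def e_def)
  have "likelihood_ratio l \<Phi> lam Q lamt0 qt T m ?s n =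
      (kappa Q qt ?s n * (\<Prod>i<n. kappa Q qt ?s i)) * ((inverse A * B) * (\<Prod>i<n. inverse (a i) * b i))"
    unfolding likelihood_ratio_def inner last prod.distrib by (simp only: mult_ac)
  also have "\<dots> = (\<Prod>i<n. c i / e i) * ((inverse A * B) * (\<Prod>i<n. inverse (a i) * b i))"
    unfolding prod_kappa kap ..
  finally have L: "likelihood_ratio l \<Phi> lam Q lamt0 qt T m ?s n = \<dots>" .
  have rt: "rate_at \<Phi> lamt T ?s i q = lamt0 (snd (p i))" for i q
    by (simp add: rate_at_def assms(1))
  \<comment> \<open>A reference rate constant along the flow turns each rejection product into a
    power. Its exponent counts the integers strictly between consecutive jump indices, matching the
    one in \<open>Z_inner\<close>.\<close>
  have W': "path_weight l \<Phi> lamt Qt \<nu> T n m p = (\<Prod>i<n. a i) * A * (\<Prod>i<n. e i)"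
    unfolding path_weight_def Let_def rt assms(2)
    by (simp add: a_def A_def e_def d_def mult_ac)
  have W: "path_weight l \<Phi> lam Q \<nu> T n m p = (\<Prod>i<n. b i) * B * (\<Prod>i<n. c i)"
    unfolding path_weight_def Let_def by (simp add: b_def B_def c_def r_def mult_ac)
  have 1: "(\<Prod>i<n. inverse (a i) * b i) * (\<Prod>i<n. a i) = (\<Prod>i<n. b i)"
    unfolding prod.distrib[symmetric] using ne by (intro prod.cong) auto
  have 2: "(\<Prod>i<n. c i / e i) * (\<Prod>i<n. e i) = (\<Prod>i<n. c i)"
    unfolding prod.distrib[symmetric] using ne by (intro prod.cong) auto
  have 3: "inverse A * A = 1" using ne by simp
  \<comment> \<open>Generic factors keep the rewriting from looking inside the products while each
    inverse moves next to its partner.\<close>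
  have "K * ((A' * B) * X) * (a * A * e) = (X * a) * (A' * A) * B * (K * e)" for K A' X a e :: real
    by (simp only: mult_ac)
  then show ?thesis unfolding L W W' by (simp only: 1 2 3 mult_1_right)
qed

text \<open>The values of \<open>U\<^sub>q\<close> for which the thinning follows \<open>p\<close> at the \<open>q\<close>-th arrival. Only one of the
  constraints is in force for a given \<open>q\<close>; in this form, following \<open>p\<close> is an intersection
  over \<open>q\<close> of independent events.\<close>

definition path_cell ::
  "real \<Rightarrow> ('k \<Rightarrow> real \<Rightarrow> real \<Rightarrow> real) \<Rightarrow> ('k \<times> real \<Rightarrow> real) \<Rightarrow> real \<Rightarrow> (nat \<Rightarrow> real) \<Rightarrow> nat \<Rightarrow>
   (nat \<Rightarrow> nat \<times> 'k) \<Rightarrow> nat \<Rightarrow> real set" where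
  "path_cell l \<Phi> lam \<nu> T n p q = (let r = rate_at \<Phi> lam T (path_seq \<Phi> \<nu> T p) in
     {u. (\<forall>i<n. fst (p i) < q \<and> q < fst (p (Suc i)) \<longrightarrow> \<not> u * l \<le> r i q) \<and>
         (\<forall>i<n. q = fst (p (Suc i)) \<longrightarrow> u * l \<le> r i q) \<and>
         (fst (p n) < q \<longrightarrow> \<not> u * l \<le> r n q)})"

definition valid_path :: "'k \<Rightarrow> nat \<Rightarrow> nat \<Rightarrow> (nat \<Rightarrow> nat \<times> 'k) \<Rightarrow> bool" where
  "valid_path \<theta> n m p \<longleftrightarrow> p 0 = (0, \<theta>) \<and> (\<forall>i<n. fst (p i) < fst (p (Suc i))) \<and> fst (p n) \<le> m"

section \<open>Index intervals of increasing sequences\<close>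

lemma increments_less:
  fixes j :: "nat \<Rightarrow> nat"
  assumes "\<forall>i<n. j i < j (Suc i)" "a < b" "b \<le> n"
  shows "j a < j b"
  using assms(2,3)
proof (induction b)
  case (Suc b)
  then have "j b < j (Suc b)" using assms(1) by simp
  with Suc show ?case by (cases "a = b") auto
qed simp

lemma increments_le:
  fixes j :: "nat \<Rightarrow> nat"
  assumes "\<forall>i<n. j i < j (Suc i)" "a \<le> b" "b \<le> n"
  shows "j a \<le> j b"
  using increments_less[OF assms(1), of a b] assms(2,3) by (cases "a = b") auto

lemma prod_consecutive_intervals:
  fixes j :: "nat \<Rightarrow> nat" and f :: "nat \<Rightarrow> real"
  assumes "\<forall>i<n. j i < j (Suc i)"
  shows "(\<Prod>q\<in>{j 0<..j n}. f q) = (\<Prod>i<n. \<Prod>q\<in>{j i<..j (Suc i)}. f q)"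
  using assms
proof (induction n)
  case (Suc n)
  have "j 0 \<le> j n" using increments_le[OF Suc.prems, of 0 n] by simp
  moreover have "j n < j (Suc n)" using Suc.prems by simp
  ultimately have "{j 0<..j (Suc n)} = {j 0<..j n} \<union> {j n<..j (Suc n)}" by auto
  then show ?case using Suc by (simp add: prod.union_disjoint)
qed simp

text \<open>Monotonicity of \<open>j\<close> separates any two such intervals. This is why an
  arrival up to the last jump meets the constraint of a single \<open>i\<close> in
  \<open>path_cell\<close>.\<close>

lemma interval_index_unique:
  fixes j :: "nat \<Rightarrow> nat"
  assumes "\<forall>i<n. j i < j (Suc i)" "i < n" "i' < n"
    and "j i < q" "q \<le> j (Suc i)" "j i' < q" "q \<le> j (Suc i')"
  shows "i' = i"
proof (rule ccontr)
  assume "i' \<noteq> i"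
  then consider "Suc i \<le> i'" | "Suc i' \<le> i" by linarith
  then show False
    using increments_le[OF assms(1), of "Suc i" i'] increments_le[OF assms(1), of "Suc i'" i] assms(2-)
    by cases auto
qed

text \<open>The arrivals 1..m are tiled by the intervals from one jump to the next and a tail after
  the last jump. Within an interval every arrival is rejected except the right endpoint, so each
  cell is a half-line with the probability of one rejection or one acceptance.\<close>

lemma prod_path_cell:
  assumes p: "valid_path \<theta> n m p" and l: "0 < l" and lam: "\<And>y. 0 < lam y" "\<And>y. lam y \<le> l"
  shows "(\<Prod>q\<in>{1..m}. measure unif01 (path_cell l \<Phi> lam \<nu> T n p q)) *
      (\<Prod>i<n. mode_prob Q (snd (p i), path_pos \<Phi> \<nu> T p (Suc i)) {snd (p (Suc i))}) =
    path_weight l \<Phi> lam Q \<nu> T n m p"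
proof -
  define j where "j i = fst (p i)" for i
  define r where "r = rate_at \<Phi> lam T (path_seq \<Phi> \<nu> T p)"
  let ?C = "path_cell l \<Phi> lam \<nu> T n p"
  have j0: "j 0 = 0" and inc: "\<forall>i<n. j i < j (Suc i)" and jn: "j n \<le> m"
    using p by (auto simp: valid_path_def j_def)
  have r: "0 \<le> r i q" "r i q \<le> l" for i q
    using lam by (auto simp: r_def rate_at_def less_imp_le)
  have C: "?C q = {u. (\<forall>i<n. j i < q \<and> q < j (Suc i) \<longrightarrow> \<not> u * l \<le> r i q) \<and>
      (\<forall>i<n. q = j (Suc i) \<longrightarrow> u * l \<le> r i q) \<and> (j n < q \<longrightarrow> \<not> u * l \<le> r n q)}" for q
    unfolding path_cell_def Let_def r_def j_def ..
  have le_jn: "j (Suc i) \<le> j n" if "i < n" for i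
    using increments_le[OF inc, of "Suc i" n] that by simp
  have rej: "measure unif01 (?C q) = 1 - r i q / l" if i: "i < n" "j i < q" "q < j (Suc i)" for i q
  proof -
    have uniq: "i' = i" if "i' < n" "j i' < q" "q \<le> j (Suc i')" for i'
      by (rule interval_index_unique[OF inc i(1) that(1) i(2) less_imp_le[OF i(3)] that(2,3)])
    have no_jump: "q \<noteq> j (Suc i')" if "i' < n" for i'
    proof
      assume q: "q = j (Suc i')"
      moreover have "j i' < q" using inc that q by simp
      ultimately have "i' = i" using uniq[OF that] by simp
      with q i(3) show False by simp
    qed
    \<comment> \<open>Stated for arbitrary \<open>R\<close>, so that it rewrites the quantified
      constraint of the cell to its single active instance.\<close>
    have a: "(\<forall>i'<n. j i' < q \<and> q < j (Suc i') \<longrightarrow> R i') \<longleftrightarrow> R i" for R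
      using uniq i less_imp_le by blast
    have b: "(\<forall>i'<n. q = j (Suc i') \<longrightarrow> R i') \<longleftrightarrow> True" for R
      using no_jump by blast
    have "\<not> j n < q" using i(3) le_jn[OF i(1)] by simp
    then have "?C q = {u. \<not> u * l \<le> r i q}" unfolding C a b by simp
    then show ?thesis using measure_unif01_le(2)[OF l r] by simp
  qed
  have acc: "measure unif01 (?C (j (Suc i))) = r i (j (Suc i)) / l" if i: "i < n" for i
  proof -
    define q where "q = j (Suc i)"
    have q: "j i < q" "q \<le> j (Suc i)" using inc i by (simp_all add: q_def)
    have uniq: "i' = i" if "i' < n" "j i' < q" "q \<le> j (Suc i')" for i'
      by (rule interval_index_unique[OF inc i that(1) q that(2,3)])
    have a: "(\<forall>i'<n. j i' < q \<and> q < j (Suc i') \<longrightarrow> R i') \<longleftrightarrow> True" for R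
    proof -
      have "\<not> (j i' < q \<and> q < j (Suc i'))" if "i' < n" for i'
        using uniq[OF that] by (auto simp: q_def)
      then show ?thesis by blast
    qed
    have b: "(\<forall>i'<n. q = j (Suc i') \<longrightarrow> R i') \<longleftrightarrow> R i" for R
    proof -
      have "i' = i" if "i' < n" "q = j (Suc i')" for i'
        using uniq[OF that(1)] inc that by simp
      then show ?thesis using i q_def by blast
    qed
    have "\<not> j n < q" using q le_jn[OF i] by simp
    then have "?C q = {u. u * l \<le> r i q}" unfolding C a b by simp
    then show ?thesis using measure_unif01_le(1)[OF l r] by (simp add: q_def)
  qed
  have last: "measure unif01 (?C q) = 1 - r n q / l" if "j n < q" for q
  proof -
    have "?C q = {u. \<not> u * l \<le> r n q}"
    proof -
      have "\<not> q < j (Suc i)" "q \<noteq> j (Suc i)" if "i < n" for i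
        using le_jn[OF that] \<open>j n < q\<close> by auto
      then show ?thesis unfolding C using that by blast
    qed
    then show ?thesis using measure_unif01_le(2)[OF l r] by simp
  qed
  have "{1..m} = {j 0<..j n} \<union> {j n<..m}" using j0 jn by auto
  then have "(\<Prod>q\<in>{1..m}. measure unif01 (?C q)) =
      (\<Prod>q\<in>{j 0<..j n}. measure unif01 (?C q)) * (\<Prod>q\<in>{j n<..m}. measure unif01 (?C q))"
    by (simp add: prod.union_disjoint)
  also have "(\<Prod>q\<in>{j n<..m}. measure unif01 (?C q)) = (\<Prod>q = j n + 1..m. 1 - r n q / l)"
    by (rule prod.cong) (auto simp: last)
  also have "(\<Prod>q\<in>{j 0<..j n}. measure unif01 (?C q)) =
      (\<Prod>i<n. \<Prod>q\<in>{j i<..j (Suc i)}. measure unif01 (?C q))"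
    by (rule prod_consecutive_intervals[OF inc])
  also have "\<dots> = (\<Prod>i<n. (\<Prod>q = j i + 1..j (Suc i) - 1. 1 - r i q / l) * (r i (j (Suc i)) / l))"
  proof (rule prod.cong[OF refl])
    fix i assume "i \<in> {..<n}"
    then have i: "i < n" by simp
    then have "{j i<..j (Suc i)} = insert (j (Suc i)) {j i + 1..j (Suc i) - 1}"
      and "j (Suc i) \<notin> {j i + 1..j (Suc i) - 1}" using inc by (auto dest!: spec[of _ i])
    then have "(\<Prod>q\<in>{j i<..j (Suc i)}. measure unif01 (?C q)) =
        measure unif01 (?C (j (Suc i))) * (\<Prod>q = j i + 1..j (Suc i) - 1. measure unif01 (?C q))"
      by simp
    also have "(\<Prod>q = j i + 1..j (Suc i) - 1. measure unif01 (?C q)) =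
        (\<Prod>q = j i + 1..j (Suc i) - 1. 1 - r i q / l)"
      by (rule prod.cong[OF refl], rule rej[OF i]) auto
    finally show "(\<Prod>q\<in>{j i<..j (Suc i)}. measure unif01 (?C q)) =
        (\<Prod>q = j i + 1..j (Suc i) - 1. 1 - r i q / l) * (r i (j (Suc i)) / l)"
      by (simp only: acc[OF i] mult.commute)
  qed
  finally show ?thesis
    unfolding path_weight_def Let_def r_def[symmetric] j_def by simp
qed

text \<open>Cells are indexed by arrivals, the thinning conditions by jumps. For a valid path all
  constrained arrivals lie in {1..m}, so exchanging the quantifiers loses nothing.\<close>

lemma ball_path_cell_iff:
  fixes \<Phi> :: "'k \<Rightarrow> real \<Rightarrow> real \<Rightarrow> real" and lam T \<nu> p
  assumes "valid_path \<theta> n m p"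
  defines "r \<equiv> rate_at \<Phi> lam T (path_seq \<Phi> \<nu> T p)"
  shows "(\<forall>q\<in>{1..m}. u q \<in> path_cell l \<Phi> lam \<nu> T n p q) \<longleftrightarrow>
    (\<forall>i<n. (\<forall>q. fst (p i) < q \<and> q < fst (p (Suc i)) \<longrightarrow> \<not> u q * l \<le> r i q) \<and>
      u (fst (p (Suc i))) * l \<le> r i (fst (p (Suc i)))) \<and>
    (\<forall>q. fst (p n) < q \<and> q \<le> m \<longrightarrow> \<not> u q * l \<le> r n q)"
proof -
  have inc: "\<forall>i<n. fst (p i) < fst (p (Suc i))" and pn: "fst (p n) \<le> m"
    using assms(1) by (auto simp: valid_path_def)
  have "fst (p (Suc i)) \<le> m \<and> 1 \<le> fst (p (Suc i))" if "i < n" for i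
  proof -
    have "fst (p (Suc i)) \<le> fst (p n)" using increments_le[OF inc, of "Suc i" n] that by simp
    moreover have "fst (p i) < fst (p (Suc i))" using inc that by simp
    ultimately show ?thesis using pn by linarith
  qed
  then show ?thesis unfolding path_cell_def Let_def r_def[symmetric] mem_Collect_eq
    by (safe; fastforce)
qed

text \<open>The arrival times increase and diverge, so those up to \<open>t\<close> have the indices
  1..c for a finite \<open>c\<close>, and \<open>N t\<close> counts them.\<close>

lemma jump_times_le_iff:
  assumes "jump_times N T" "0 \<le> t"
  shows "T j \<le> t \<longleftrightarrow> j \<le> N t"
proof -
  have T: "T 0 = 0" "strict_mono T" "filterlim T at_top sequentially"
    and N: "N t = card {k. 1 \<le> k \<and> T k \<le> t}"
    using assms by (auto simp: jump_times_def)
  have "eventually (\<lambda>i. t < T i) sequentially"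
    using T(3) by (simp add: filterlim_at_top_dense)
  then obtain i where i: "t < T (Suc i)"
    unfolding eventually_sequentially by (meson Suc_n_not_le_n nat_le_linear)
  define c where "c = (LEAST i. t < T (Suc i))"
  have c: "t < T (Suc c)" unfolding c_def using i by (rule LeastI)
  have c': "T c \<le> t"
  proof (cases c)
    case (Suc i)
    have "\<not> t < T (Suc i)"
      by (rule not_less_Least[of i "\<lambda>i. t < T (Suc i)", folded c_def]) (simp add: Suc)
    then show ?thesis by (simp add: Suc)
  qed (use T(1) assms(2) in simp)
  have le: "T j \<le> t \<longleftrightarrow> j \<le> c" for j
  proof
    assume "T j \<le> t"
    then have "T j < T (Suc c)" using c by simp
    then show "j \<le> c" using T(2) by (simp add: strict_mono_less)
  next
    assume "j \<le> c"
    then have "T j \<le> T c" using T(2) by (simp add: strict_mono_less_eq)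
    then show "T j \<le> t" using c' by simp
  qed
  have "{k. 1 \<le> k \<and> T k \<le> t} = {1..c}" unfolding le by auto
  then show ?thesis using le N by simp
qed

section \<open>Integration over the data\<close>

abbreviation seq_space :: "(nat \<Rightarrow> real) measure" where
  "seq_space \<equiv> \<Pi>\<^sub>M i\<in>{1..}. borel"

lemma seq_space_box:
  assumes J: "finite J" "J \<subseteq> {1..}" and C: "\<And>q. q \<in> J \<Longrightarrow> C q \<in> sets borel"
  shows "{b \<in> space seq_space. \<forall>q\<in>J. b q \<in> C q} \<in> sets seq_space"
proof (rule sets.sets_Collect_finite_All[OF _ J(1)])
  fix q assume q: "q \<in> J"
  then have "(\<lambda>b. b q) \<in> seq_space \<rightarrow>\<^sub>M borel"
    using J(2) by (intro measurable_component_singleton) auto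
  then show "{b \<in> space seq_space. b q \<in> C q} \<in> sets seq_space"
    using measurable_sets_Collect[of "\<lambda>b. b q" seq_space borel "\<lambda>u. u \<in> C q"] C[OF q] by simp
qed

text \<open>Only finitely many coordinates are constrained, so independence of finite subfamilies
  gives the product.\<close>

lemma (in prob_space) iid_uniform_box:
  assumes U: "iid_uniform U" and J: "finite J" "J \<subseteq> {1..}" and C: "\<And>q. q \<in> J \<Longrightarrow> C q \<in> sets borel"
  shows "emeasure (distr M seq_space (\<lambda>\<omega>. restrict (U \<omega>) {1..})) {b \<in> space seq_space. \<forall>q\<in>J. b q \<in> C q} =
    ennreal (\<Prod>q\<in>J. measure unif01 (C q))"
proof -
  have indep: "indep_vars (\<lambda>_. borel) (\<lambda>k \<omega>. U \<omega> k) {1..}"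
    and distr: "\<And>k. 1 \<le> k \<Longrightarrow> distr M borel (\<lambda>\<omega>. U \<omega> k) = unif01"
    using U by (auto simp: iid_uniform_def)
  have rv [measurable]: "(\<lambda>\<omega>. U \<omega> k) \<in> borel_measurable M" if "k \<in> {1..}" for k
    using indep that by (auto simp: indep_vars_def)
  have 1: "(\<lambda>\<omega>. restrict (U \<omega>) {1..}) \<in> M \<rightarrow>\<^sub>M seq_space"
    by (rule measurable_restrict) (rule rv)
  have 2: "{b \<in> space seq_space. \<forall>q\<in>J. b q \<in> C q} \<in> sets seq_space"
    by (rule seq_space_box[OF J C])
  have "(\<lambda>\<omega>. restrict (U \<omega>) {1..}) -` {b \<in> space seq_space. \<forall>q\<in>J. b q \<in> C q} \<inter> space M =
      {\<omega> \<in> space M. \<forall>q\<in>J. U \<omega> q \<in> C q}"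
    using J(2) measurable_space[OF 1] by auto
  then have "emeasure (distr M seq_space (\<lambda>\<omega>. restrict (U \<omega>) {1..})) {b \<in> space seq_space. \<forall>q\<in>J. b q \<in> C q} =
      ennreal (prob {\<omega> \<in> space M. \<forall>q\<in>J. U \<omega> q \<in> C q})"
    using emeasure_distr[OF 1 2] by (simp add: emeasure_eq_measure)
  also have "prob {\<omega> \<in> space M. \<forall>q\<in>J. U \<omega> q \<in> C q} = (\<Prod>q\<in>J. measure unif01 (C q))"
  \<comment> \<open>\<open>indep_varsD\<close> wants a nonempty index set, while \<open>J\<close> is
    empty when there is no arrival or no jump.\<close>
  proof (cases "J = {}")
    case False
    then have "{\<omega> \<in> space M. \<forall>q\<in>J. U \<omega> q \<in> C q} = (\<Inter>q\<in>J. (\<lambda>\<omega>. U \<omega> q) -` C q \<inter> space M)"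
      by auto
    moreover have "prob (\<Inter>q\<in>J. (\<lambda>\<omega>. U \<omega> q) -` C q \<inter> space M) =
        (\<Prod>q\<in>J. prob ((\<lambda>\<omega>. U \<omega> q) -` C q \<inter> space M))"
      using indep_varsD[OF indep False J C] by simp
    moreover have "prob ((\<lambda>\<omega>. U \<omega> q) -` C q \<inter> space M) = measure unif01 (C q)" if "q \<in> J" for q
      using measure_distr[OF rv C[OF that], of q] distr[of q] J(2) that by auto
    ultimately show ?thesis by simp
  qed (simp add: prob_space)
  finally show ?thesis .
qed

lemma likelihood_ratio_cong:
  assumes "\<And>i. i \<le> n \<Longrightarrow> S i = S' i"
  shows "likelihood_ratio l \<Phi> lam Q lamt qt T m S n = likelihood_ratio l \<Phi> lam Q lamt qt T m S' n"
proof -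
  have *: "tau S i = tau S' i" "mode S i = mode S' i" "pos S i = pos S' i" if "i \<le> n" for i
    using assms[OF that] by (simp_all add: tau_def mode_def pos_def)
  have r: "rate_at \<Phi> lam T S i q = rate_at \<Phi> lam T S' i q" if "i \<le> n" for i q
    using * that by (simp add: rate_at_def)
  have kap: "kappa Q qt S i = kappa Q qt S' i" if "i \<le> n" for i
    using * that by (simp add: kappa_def)
  have "Z_inner l \<Phi> lam Q lamt qt T S i = Z_inner l \<Phi> lam Q lamt qt T S' i" if "i < n" for i
    using * r kap that by (simp add: Z_inner_def)
  moreover have "Z_last l \<Phi> lam Q lamt qt T m S n = Z_last l \<Phi> lam Q lamt qt T m S' n"
    using * r kap by (simp add: Z_last_def)
  ultimately show ?thesis by (simp add: likelihood_ratio_def)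
qed

text \<open>This lets the ratio pass under \<open>ennreal\<close>, which would truncate negative
  values to 0.\<close>

lemma likelihood_ratio_nonneg:
  assumes "\<And>y. 0 < lam y" "\<And>y. lam y \<le> l"
    and "\<And>\<theta> \<theta>'. 0 < qt \<theta> \<theta>'" and "\<And>\<theta>. 0 < lamt0 \<theta> \<and> lamt0 \<theta> < l"
  shows "0 \<le> likelihood_ratio l \<Phi> lam Q lamt0 qt T m S n"
proof -
  have l: "0 < l" using assms(4) by (meson less_trans)
  have r: "0 \<le> rate_at \<Phi> lam T S i q / l" "0 \<le> 1 - rate_at \<Phi> lam T S i q / l" for i q
    using assms(1,2) l by (auto simp: rate_at_def less_imp_le)
  have d: "0 \<le> lamt0 \<theta> / l" "0 \<le> 1 - lamt0 \<theta> / l" for \<theta>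
    using assms(4)[of \<theta>] l by auto
  have kap: "0 \<le> kappa Q qt S i" for i
    using assms(3) by (auto simp: kappa_def mode_prob_nonneg less_imp_le)
  have "0 \<le> Z_inner l \<Phi> lam Q lamt0 qt T S i" for i
    unfolding Z_inner_def
    by (intro mult_nonneg_nonneg kap r prod_nonneg inverse_nonnegative_iff_nonnegative[THEN iffD2] zero_le_power d)
  moreover have "0 \<le> Z_last l \<Phi> lam Q lamt0 qt T m S n"
    unfolding Z_last_def
    by (intro mult_nonneg_nonneg kap r prod_nonneg inverse_nonnegative_iff_nonnegative[THEN iffD2] zero_le_power d)
  ultimately show ?thesis
    unfolding likelihood_ratio_def by (intro mult_nonneg_nonneg prod_nonneg) auto
qed

text \<open>The arrival times as a function of the random sequence indexed by \<open>{1..}\<close>, which is undefined at 0.\<close>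

definition arrivals :: "(nat \<Rightarrow> real) \<Rightarrow> nat \<Rightarrow> real" where
  "arrivals a = a(0 := 0)"

lemma arrivals_measurable [measurable]: "(\<lambda>a. arrivals a j) \<in> borel_measurable seq_space"
proof (cases "j = 0")
  case False
  then have "(\<lambda>a. a j) \<in> borel_measurable seq_space" by (intro measurable_component_singleton) auto
  with False show ?thesis by (simp add: arrivals_def)
qed (simp add: arrivals_def)

text \<open>Indexed from 1 like \<open>V\<close>: cell \<open>i\<close> governs the transition from
  step \<open>i - 1\<close> to step \<open>i\<close>.\<close>

definition mode_cell ::
  "(nat \<Rightarrow> 'k) \<Rightarrow> nat set \<Rightarrow> ('k \<Rightarrow> real \<Rightarrow> real \<Rightarrow> real) \<Rightarrow> ('k \<times> real \<Rightarrow> ('k \<times> real) measure) \<Rightarrow>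
   real \<Rightarrow> (nat \<Rightarrow> real) \<Rightarrow> (nat \<Rightarrow> nat \<times> 'k) \<Rightarrow> nat \<Rightarrow> real set" where
  "mode_cell k I \<Phi> Q \<nu> T p i =
     {v. select_mode k I Q (snd (p (i - 1)), path_pos \<Phi> \<nu> T p i) v = snd (p i)}"

section \<open>The random trace of the thinning\<close>

text \<open>Measurability of the flow is asked on the whole plane because the integrands are
  functions of arbitrary sequences of arrival times, whose differences may be negative.\<close>

locale thinned_poisson = prob_space M for M :: "'w measure" +
  fixes ls :: real and Nstar :: "'w \<Rightarrow> real \<Rightarrow> nat" and Tstar U V :: "'w \<Rightarrow> nat \<Rightarrow> real"
    and k :: "nat \<Rightarrow> 'k" and I :: "nat set"
    and \<Phi> :: "'k \<Rightarrow> real \<Rightarrow> real \<Rightarrow> real"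
    and x :: "'k \<times> real" and t :: real
  assumes data: "thinning_data ls Nstar Tstar U V"
    and enum: "enumeration k I"
    and flow_measurable: "\<And>\<theta>. (\<lambda>(s, \<nu>). \<Phi> \<theta> s \<nu>) \<in> borel_measurable (borel \<Otimes>\<^sub>M borel)"
    and t_nonneg: "0 \<le> t"
begin

abbreviation thin where
  "thin lam Q \<omega> \<equiv> thinning ls k I \<Phi> lam Q x (Tstar \<omega>) (U \<omega>) (V \<omega>)"

text \<open>Restriction to {..n} leaves finitely many free values, hence countably many traces. The
  arrival count is recorded too, because the likelihood ratio depends on it.\<close>

definition trace where
  "trace lam Q \<omega> = (let n = jump_count (Tstar \<omega>) (thin lam Q \<omega>) t in
     (n, Nstar \<omega> t, restrict (\<lambda>i. (tau (thin lam Q \<omega>) i, mode (thin lam Q \<omega>) i)) {..n}))"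

definition traces :: "(nat \<times> nat \<times> (nat \<Rightarrow> nat \<times> 'k)) set" where
  "traces = (SIGMA n : UNIV. UNIV \<times> ({..n} \<rightarrow>\<^sub>E UNIV))"

lemma countable_traces: "countable traces"
proof -
  have "countable (UNIV :: (nat \<times> 'k) set)"
    unfolding UNIV_Times_UNIV[symmetric] using enumeration_countable[OF enum] by (intro countable_SIGMA) auto
  then show ?thesis unfolding traces_def by (intro countable_SIGMA countable_PiE) auto
qed

lemma trace_in_traces: "trace lam Q \<omega> \<in> traces"
  by (simp add: trace_def traces_def Let_def)

lemma ls_pos: "0 < ls"
  using data by (simp add: thinning_data_def poisson_process_def)

lemma jump_times: "\<omega> \<in> space M \<Longrightarrow> jump_times (Nstar \<omega>) (Tstar \<omega>)"
  using data by (simp add: thinning_data_def poisson_process_def)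

lemma thinning_path: "\<omega> \<in> space M \<Longrightarrow> thinning_path (Tstar \<omega>) t (Nstar \<omega> t)"
  using jump_times[of \<omega>] jump_times_le_iff[OF jump_times t_nonneg, of \<omega>]
  by (simp add: thinning_path_def jump_times_def)

lemma arrivals_restrict: "\<omega> \<in> space M \<Longrightarrow> arrivals (restrict (Tstar \<omega>) {1..}) = Tstar \<omega>"
  using jump_times[of \<omega>] by (auto simp: arrivals_def jump_times_def fun_eq_iff)

text \<open>The sequences enter in layers: a condition on \<open>a\<close> alone, then for given
  \<open>a\<close> a box for \<open>b\<close> and a box for \<open>c\<close>. Iterated integration
  evaluates this shape directly.\<close>

definition trace_event where
  "trace_event lam Q n m p a b c \<longleftrightarrow> valid_path (fst x) n m p \<and> arrivals a m \<le> t \<and> t < arrivals a (Suc m) \<and>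
     (\<forall>q\<in>{1..m}. b q \<in> path_cell ls \<Phi> lam (snd x) (arrivals a) n p q) \<and>
     (\<forall>i\<in>{1..n}. c i \<in> mode_cell k I \<Phi> Q (snd x) (arrivals a) p i)"

lemma trace_eq_iff:
  assumes \<omega>: "\<omega> \<in> space M" and p: "p \<in> extensional {..n}"
  shows "trace lam Q \<omega> = (n, m, p) \<longleftrightarrow>
    trace_event lam Q n m p (restrict (Tstar \<omega>) {1..}) (restrict (U \<omega>) {1..}) (restrict (V \<omega>) {1..})"
proof -
  interpret thinning_path ls k I \<Phi> lam Q x "Tstar \<omega>" "U \<omega>" "V \<omega>" t "Nstar \<omega> t"
    by (rule thinning_path[OF \<omega>])
  let ?T = "Tstar \<omega>" and ?S = "thin lam Q \<omega>"
  let ?r = "rate_at \<Phi> lam ?T (path_seq \<Phi> (snd x) ?T p)"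
  \<comment> \<open>The count is expressed through two arrival times, since the counting path is not
    itself among the three independent sequences.\<close>
  have m: "Nstar \<omega> t = m \<longleftrightarrow> ?T m \<le> t \<and> t < ?T (Suc m)"
    unfolding T_le_t_iff not_le[symmetric] by auto
  have "trace lam Q \<omega> = (n, m, p) \<longleftrightarrow> Nstar \<omega> t = m \<and>
      (jump_count ?T ?S t = n \<and> restrict (\<lambda>i. (tau ?S i, mode ?S i)) {..n} = p)"
    by (auto simp: trace_def Let_def)
  also have "\<dots> \<longleftrightarrow> Nstar \<omega> t = m \<and> valid_path (fst x) n m p \<and>
      (\<forall>i<n. (\<forall>q. fst (p i) < q \<and> q < fst (p (Suc i)) \<longrightarrow> \<not> U \<omega> q * ls \<le> ?r i q) \<and>
        U \<omega> (fst (p (Suc i))) * ls \<le> ?r i (fst (p (Suc i)))) \<and>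
      (\<forall>q. fst (p n) < q \<and> q \<le> m \<longrightarrow> \<not> U \<omega> q * ls \<le> ?r n q) \<and>
      (\<forall>i<n. select_mode k I Q (snd (p i), path_pos \<Phi> (snd x) ?T p (Suc i)) (V \<omega> (Suc i)) = snd (p (Suc i)))"
    unfolding jump_count_trace_iff[OF p] thinning_eq_path_seq_iff valid_path_def by blast
  also have "\<dots> \<longleftrightarrow> Nstar \<omega> t = m \<and> valid_path (fst x) n m p \<and>
      (\<forall>q\<in>{1..m}. U \<omega> q \<in> path_cell ls \<Phi> lam (snd x) ?T n p q) \<and>
      (\<forall>i<n. select_mode k I Q (snd (p i), path_pos \<Phi> (snd x) ?T p (Suc i)) (V \<omega> (Suc i)) = snd (p (Suc i)))"
    using ball_path_cell_iff[of "fst x" n m p "U \<omega>" ls \<Phi> lam "snd x" ?T] by blast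
  also have "(\<forall>i<n. select_mode k I Q (snd (p i), path_pos \<Phi> (snd x) ?T p (Suc i)) (V \<omega> (Suc i)) = snd (p (Suc i)))
      \<longleftrightarrow> (\<forall>i\<in>{1..n}. V \<omega> i \<in> mode_cell k I \<Phi> Q (snd x) ?T p i)"
  proof -
    have "(\<forall>i\<in>{1..n}. P i) \<longleftrightarrow> (\<forall>i<n. P (Suc i))" for P
      by (metis One_nat_def Suc_le_eq Suc_le_mono Suc_pred atLeastAtMost_iff zero_less_Suc le_zero_eq not_less_eq_eq)
    then show ?thesis by (simp add: mode_cell_def)
  qed
  finally show ?thesis
    unfolding trace_event_def arrivals_restrict[OF \<omega>] m by auto
qed

lemma trace_unfold:
  assumes \<omega>: "\<omega> \<in> space M" and c: "trace lam Q \<omega> = (n, m, p)"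
  shows "jump_count (Tstar \<omega>) (thin lam Q \<omega>) t = n" "Nstar \<omega> t = m"
    "i \<le> n \<Longrightarrow> thin lam Q \<omega> i = path_seq \<Phi> (snd x) (Tstar \<omega>) p i"
proof -
  interpret thinning_path ls k I \<Phi> lam Q x "Tstar \<omega>" "U \<omega>" "V \<omega>" t "Nstar \<omega> t"
    by (rule thinning_path[OF \<omega>])
  have p: "p \<in> extensional {..n}" using c by (auto simp: trace_def Let_def)
  show "jump_count (Tstar \<omega>) (thin lam Q \<omega>) t = n" "Nstar \<omega> t = m"
    using c by (auto simp: trace_def Let_def)
  then have "jump_count (Tstar \<omega>) (thin lam Q \<omega>) t = n \<and>
      restrict (\<lambda>i. (tau (thin lam Q \<omega>) i, mode (thin lam Q \<omega>) i)) {..n} = p"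
    using c by (auto simp: trace_def Let_def)
  then show "i \<le> n \<Longrightarrow> thin lam Q \<omega> i = path_seq \<Phi> (snd x) (Tstar \<omega>) p i"
    unfolding jump_count_trace_iff[OF p] by blast
qed

section \<open>Measurability for a fixed path\<close>

lemma flow_measurable':
  assumes [measurable]: "f \<in> borel_measurable N" "h \<in> borel_measurable N"
  shows "(\<lambda>a. \<Phi> \<theta> (f a) (h a)) \<in> borel_measurable N"
proof -
  have "(\<lambda>a. (f a, h a)) \<in> N \<rightarrow>\<^sub>M borel \<Otimes>\<^sub>M borel" by measurable
  from measurable_compose[OF this flow_measurable] show ?thesis by simp
qed

lemma path_pos_measurable [measurable]:
  "(\<lambda>a. path_pos \<Phi> \<nu> (arrivals a) p i) \<in> borel_measurable seq_space"
proof (induction i)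
  case (Suc i)
  note [measurable] = Suc.IH
  show ?case unfolding path_pos.simps(2) by (intro flow_measurable') measurable
qed simp

lemma Pair_state_space:
  "f \<in> borel_measurable N \<Longrightarrow> (\<lambda>a. (\<theta>, f a)) \<in> N \<rightarrow>\<^sub>M state_space"
  unfolding state_space_def by measurable

lemma rate_at_measurable:
  assumes "pdp_characteristics \<Phi>' lam Q"
  shows "(\<lambda>a. rate_at \<Phi> lam (arrivals a) (path_seq \<Phi> \<nu> (arrivals a) p) i q) \<in> borel_measurable seq_space"
proof -
  have lam: "lam \<in> borel_measurable state_space" using assms by (simp add: pdp_characteristics_def)
  show ?thesis unfolding rate_at_def path_seq_simps
    by (intro measurable_compose[OF Pair_state_space lam] flow_measurable') measurable
qed

lemma mode_prob_path_measurable: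
  assumes "pdp_characteristics \<Phi>' lam Q"
  shows "(\<lambda>a. mode_prob Q (\<theta>, path_pos \<Phi> \<nu> (arrivals a) p i) A) \<in> borel_measurable seq_space"
  by (intro measurable_compose[OF Pair_state_space mode_prob_measurable[OF assms]] path_pos_measurable)

lemma likelihood_ratio_measurable:
  assumes "pdp_characteristics \<Phi>' lam Q"
  shows "(\<lambda>a. likelihood_ratio ls \<Phi> lam Q lamt0 qt (arrivals a) m (path_seq \<Phi> \<nu> (arrivals a) p) n)
    \<in> borel_measurable seq_space"
proof -
  note [measurable] = rate_at_measurable[OF assms]
  have [measurable]: "(\<lambda>a. kappa Q qt (path_seq \<Phi> \<nu> (arrivals a) p) i) \<in> borel_measurable seq_space" for i
  proof (cases i)
    case (Suc j)
    then show ?thesis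
      unfolding kappa_def path_seq_simps using mode_prob_path_measurable[OF assms]
      by (simp add: borel_measurable_divide)
  qed (simp add: kappa_def)
  show ?thesis
    unfolding likelihood_ratio_def Z_last_def Z_inner_def path_seq_simps by measurable
qed

text \<open>The maps \<open>h\<close> and \<open>u\<close> are left general: a constant
  \<open>h\<close> yields measurability of one cell, projections yield that of the joint
  event.\<close>

lemma path_cell_pred:
  assumes "pdp_characteristics \<Phi>' lam Q" and [measurable]: "h \<in> N \<rightarrow>\<^sub>M seq_space" "u \<in> borel_measurable N"
  shows "Measurable.pred N (\<lambda>z. u z \<in> path_cell ls \<Phi> lam \<nu> (arrivals (h z)) n p q)"
proof -
  have [measurable]: "(\<lambda>z. rate_at \<Phi> lam (arrivals (h z)) (path_seq \<Phi> \<nu> (arrivals (h z)) p) i q) \<in> borel_measurable N" for i q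
    by (rule measurable_compose[OF assms(2) rate_at_measurable[OF assms(1)]])
  show ?thesis unfolding path_cell_def Let_def mem_Collect_eq by measurable
qed

lemma mode_cell_pred:
  assumes "pdp_characteristics \<Phi>' lam Q" and [measurable]: "h \<in> N \<rightarrow>\<^sub>M seq_space" "u \<in> borel_measurable N"
  shows "Measurable.pred N (\<lambda>z. u z \<in> mode_cell k I \<Phi> Q \<nu> (arrivals (h z)) p i)"
  unfolding mode_cell_def mem_Collect_eq
  by (intro select_mode_measurable[OF assms(1) enum] Pair_state_space assms(3)
      measurable_compose[OF assms(2) path_pos_measurable])

lemma seq_space_component: "i \<in> {1..n} \<Longrightarrow> (\<lambda>b. b i) \<in> borel_measurable seq_space"
  by (intro measurable_component_singleton) auto

lemma trace_event_measurable:
  assumes "pdp_characteristics \<Phi>' lam Q"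
  shows "Measurable.pred (seq_space \<Otimes>\<^sub>M seq_space \<Otimes>\<^sub>M seq_space) (\<lambda>(a, b, c). trace_event lam Q n m p a b c)"
proof -
  have "Measurable.pred (seq_space \<Otimes>\<^sub>M seq_space \<Otimes>\<^sub>M seq_space)
      (\<lambda>z. fst (snd z) q \<in> path_cell ls \<Phi> lam (snd x) (arrivals (fst z)) n p q)" if "q \<in> {1..m}" for q
    by (intro path_cell_pred[OF assms] measurable_compose[OF _ seq_space_component[OF that]]) measurable
  moreover have "Measurable.pred (seq_space \<Otimes>\<^sub>M seq_space \<Otimes>\<^sub>M seq_space)
      (\<lambda>z. snd (snd z) i \<in> mode_cell k I \<Phi> Q (snd x) (arrivals (fst z)) p i)" if "i \<in> {1..n}" for i
    by (intro mode_cell_pred[OF assms] measurable_compose[OF _ seq_space_component[OF that]]) measurable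
  moreover have "(\<lambda>z. arrivals (fst z) j) \<in> borel_measurable (seq_space \<Otimes>\<^sub>M seq_space \<Otimes>\<^sub>M seq_space)" for j
    by (rule measurable_compose[OF measurable_fst arrivals_measurable])
  then have "Measurable.pred (seq_space \<Otimes>\<^sub>M seq_space \<Otimes>\<^sub>M seq_space) (\<lambda>z. arrivals (fst z) m \<le> t)"
    and "Measurable.pred (seq_space \<Otimes>\<^sub>M seq_space \<Otimes>\<^sub>M seq_space) (\<lambda>z. t < arrivals (fst z) (Suc m))"
    by measurable
  ultimately show ?thesis
    unfolding trace_event_def case_prod_beta
    by (intro pred_intros_logic pred_intros_finite) auto
qed

definition X where "X i \<omega> = restrict (([Tstar, U, V] ! i) \<omega>) {1..}"

lemma X_simps: "X 0 \<omega> = restrict (Tstar \<omega>) {1..}" "X 1 \<omega> = restrict (U \<omega>) {1..}" "X 2 \<omega> = restrict (V \<omega>) {1..}"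
  by (simp_all add: X_def)

lemma indep_X: "indep_vars (\<lambda>_. seq_space) X {..<3}"
  using data by (simp add: thinning_data_def X_def[abs_def])

lemma X_measurable: "i < 3 \<Longrightarrow> X i \<in> M \<rightarrow>\<^sub>M seq_space"
  using indep_X by (auto simp: indep_vars_def)

section \<open>Law of the trace given the arrival times\<close>

text \<open>With \<open>a\<close> fixed the trace event is a product of two boxes, so the inner
  integrals are products of uniform probabilities, evaluated by \<open>prod_path_cell\<close> and
  \<open>measure_select_mode\<close>. The factor \<open>F\<close> depends on the arrivals only and
  passes outside; it will carry the state and the ratio.\<close>

lemma trace_law:
  assumes char: "pdp_characteristics \<Phi>' lam Q" and lam: "\<And>y. lam y \<le> ls"
    and p: "p \<in> extensional {..n}" and F [measurable]: "F \<in> borel_measurable seq_space"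
  shows "(\<integral>\<^sup>+\<omega>. F (X 0 \<omega>) * indicator {\<omega>. trace lam Q \<omega> = (n, m, p)} \<omega> \<partial>M) =
    (\<integral>\<^sup>+a. F a * indicator {a. valid_path (fst x) n m p \<and> arrivals a m \<le> t \<and> t < arrivals a (Suc m)} a *
       ennreal (path_weight ls \<Phi> lam Q (snd x) (arrivals a) n m p) \<partial>distr M seq_space (X 0))"
proof -
  let ?L = "\<lambda>i. distr M seq_space (X i)"
  let ?E = "{a. valid_path (fst x) n m p \<and> arrivals a m \<le> t \<and> t < arrivals a (Suc m)}"
  let ?f = "\<lambda>a b c. F a * indicator {(a, b, c). trace_event lam Q n m p a b c} (a, b, c)"
  let ?B = "\<lambda>a. {b \<in> space seq_space. \<forall>q\<in>{1..m}. b q \<in> path_cell ls \<Phi> lam (snd x) (arrivals a) n p q}"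
  let ?D = "\<lambda>a. {c \<in> space seq_space. \<forall>i\<in>{1..n}. c i \<in> mode_cell k I \<Phi> Q (snd x) (arrivals a) p i}"
  have lam_pos: "0 < lam y" for y using char unfolding pdp_characteristics_def by blast
  have f: "(\<lambda>(a, b, c). ?f a b c) \<in> borel_measurable (seq_space \<Otimes>\<^sub>M seq_space \<Otimes>\<^sub>M seq_space)"
  proof -
    note [measurable] = trace_event_measurable[OF char, of n m p]
    have "(\<lambda>z. if (\<lambda>(a, b, c). trace_event lam Q n m p a b c) z then F (fst z) else 0)
        \<in> borel_measurable (seq_space \<Otimes>\<^sub>M seq_space \<Otimes>\<^sub>M seq_space)"
      by measurable
    also have "(\<lambda>z. if (\<lambda>(a, b, c). trace_event lam Q n m p a b c) z then F (fst z) else 0) =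
        (\<lambda>(a, b, c). ?f a b c)"
      by (auto simp: fun_eq_iff)
    finally show ?thesis .
  qed
  have cell: "path_cell ls \<Phi> lam (snd x) (arrivals a) n p q \<in> sets borel" if "a \<in> space seq_space" for a q
    using path_cell_pred[OF char, of "\<lambda>_. a" borel "\<lambda>u. u"] that by (simp add: pred_def)
  have mcell: "mode_cell k I \<Phi> Q (snd x) (arrivals a) p i \<in> sets borel" if "a \<in> space seq_space" for a i
    using mode_cell_pred[OF char, of "\<lambda>_. a" borel "\<lambda>u. u"] that by (simp add: pred_def)
  have B: "emeasure (?L 1) (?B a) = ennreal (\<Prod>q\<in>{1..m}. measure unif01 (path_cell ls \<Phi> lam (snd x) (arrivals a) n p q))"
    "?B a \<in> sets seq_space" if a: "a \<in> space seq_space" for a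
  proof -
    have "X 1 = (\<lambda>\<omega>. restrict (U \<omega>) {1..})" by (rule ext) (rule X_simps)
    moreover have "iid_uniform U" using data by (simp add: thinning_data_def)
    ultimately show "emeasure (?L 1) (?B a) =
        ennreal (\<Prod>q\<in>{1..m}. measure unif01 (path_cell ls \<Phi> lam (snd x) (arrivals a) n p q))"
      using iid_uniform_box[of U "{1..m}" "path_cell ls \<Phi> lam (snd x) (arrivals a) n p"] cell[OF a] by simp
    show "?B a \<in> sets seq_space"
      by (rule seq_space_box) (auto intro: cell[OF a])
  qed
  have D: "emeasure (?L 2) (?D a) = ennreal (\<Prod>i\<in>{1..n}. measure unif01 (mode_cell k I \<Phi> Q (snd x) (arrivals a) p i))"
    "?D a \<in> sets seq_space" if a: "a \<in> space seq_space" for a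
  proof -
    have "X 2 = (\<lambda>\<omega>. restrict (V \<omega>) {1..})" by (rule ext) (rule X_simps)
    moreover have "iid_uniform V" using data by (simp add: thinning_data_def)
    ultimately show "emeasure (?L 2) (?D a) =
        ennreal (\<Prod>i\<in>{1..n}. measure unif01 (mode_cell k I \<Phi> Q (snd x) (arrivals a) p i))"
      using iid_uniform_box[of V "{1..n}" "mode_cell k I \<Phi> Q (snd x) (arrivals a) p"] mcell[OF a] by simp
    show "?D a \<in> sets seq_space"
      by (rule seq_space_box) (auto intro: mcell[OF a])
  qed
  have "(\<integral>\<^sup>+\<omega>. F (X 0 \<omega>) * indicator {\<omega>. trace lam Q \<omega> = (n, m, p)} \<omega> \<partial>M) =
      (\<integral>\<^sup>+\<omega>. ?f (X 0 \<omega>) (X 1 \<omega>) (X 2 \<omega>) \<partial>M)"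
    by (rule nn_integral_cong) (simp add: trace_eq_iff[OF _ p] X_simps indicator_def del: One_nat_def)
  also have "\<dots> = (\<integral>\<^sup>+a. \<integral>\<^sup>+b. \<integral>\<^sup>+c. ?f a b c \<partial>?L 2 \<partial>?L 1 \<partial>?L 0)"
    by (rule nn_integral_indep_vars_3[OF indep_X f])
  also have "\<dots> = (\<integral>\<^sup>+a. F a * indicator ?E a * ennreal (path_weight ls \<Phi> lam Q (snd x) (arrivals a) n m p) \<partial>?L 0)"
  proof (rule nn_integral_cong)
    fix a assume "a \<in> space (?L 0)"
    then have a: "a \<in> space seq_space" by simp
    have "(\<integral>\<^sup>+b. \<integral>\<^sup>+c. ?f a b c \<partial>?L 2 \<partial>?L 1) =
        (\<integral>\<^sup>+b. \<integral>\<^sup>+c. (F a * indicator ?E a) * indicator (?B a) b * indicator (?D a) c \<partial>?L 2 \<partial>?L 1)"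
      by (intro nn_integral_cong) (auto simp: trace_event_def indicator_def)
    also have "\<dots> = F a * indicator ?E a * (emeasure (?L 1) (?B a) * emeasure (?L 2) (?D a))"
      using B(2)[OF a] D(2)[OF a]
      by (simp add: nn_integral_cmult nn_integral_multc nn_integral_cmult_indicator mult.assoc)
    \<comment> \<open>The product formula is used for valid paths; for the others the indicator
      makes both sides 0.\<close>
    also have "emeasure (?L 1) (?B a) * emeasure (?L 2) (?D a) = ennreal (path_weight ls \<Phi> lam Q (snd x) (arrivals a) n m p)"
      if valid: "valid_path (fst x) n m p"
    proof -
      have "measure unif01 (mode_cell k I \<Phi> Q (snd x) (arrivals a) p (Suc i)) =
          mode_prob Q (snd (p i), path_pos \<Phi> (snd x) (arrivals a) p (Suc i)) {snd (p (Suc i))}" for i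
        using measure_select_mode[OF char enum] mcell[OF a, of "Suc i"] by (simp add: mode_cell_def)
      then have "(\<Prod>i\<in>{1..n}. measure unif01 (mode_cell k I \<Phi> Q (snd x) (arrivals a) p i)) =
          (\<Prod>i<n. mode_prob Q (snd (p i), path_pos \<Phi> (snd x) (arrivals a) p (Suc i)) {snd (p (Suc i))})"
        by (simp add: prod.atLeast1_atMost_eq)
      then show ?thesis
        unfolding B(1)[OF a] D(1)[OF a] prod_path_cell[OF valid ls_pos lam_pos lam, symmetric]
        by (simp add: ennreal_mult'' prod_nonneg mode_prob_nonneg)
    qed
    then have "F a * indicator ?E a * (emeasure (?L 1) (?B a) * emeasure (?L 2) (?D a)) =
        F a * indicator ?E a * ennreal (path_weight ls \<Phi> lam Q (snd x) (arrivals a) n m p)"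
      by (cases "valid_path (fst x) n m p") auto
    finally show "(\<integral>\<^sup>+b. \<integral>\<^sup>+c. ?f a b c \<partial>?L 2 \<partial>?L 1) = \<dots>" .
  qed
  finally show ?thesis .
qed

text \<open>The range is countable, so preimages of singletons suffice, and
  \<open>trace_eq_iff\<close> describes these.\<close>

lemma measurable_trace:
  assumes char: "pdp_characteristics \<Phi>' lam Q"
  shows "trace lam Q \<in> M \<rightarrow>\<^sub>M count_space traces"
proof (subst measurable_count_space_eq_countable[OF countable_traces], intro conjI ballI)
  show "trace lam Q \<in> space M \<rightarrow> traces" by (simp add: trace_in_traces)
  fix y assume "y \<in> traces"
  then obtain n m p where y: "y = (n, m, p)" and p: "p \<in> extensional {..n}"
    by (auto simp: traces_def PiE_def)
  have [measurable]: "X 0 \<in> M \<rightarrow>\<^sub>M seq_space" "X 1 \<in> M \<rightarrow>\<^sub>M seq_space" "X 2 \<in> M \<rightarrow>\<^sub>M seq_space"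
    by (rule X_measurable; simp)+
  have "(\<lambda>\<omega>. (X 0 \<omega>, X 1 \<omega>, X 2 \<omega>)) \<in> M \<rightarrow>\<^sub>M seq_space \<Otimes>\<^sub>M seq_space \<Otimes>\<^sub>M seq_space"
    by measurable
  from measurable_compose[OF this trace_event_measurable[OF char, of n m p]]
  have "Measurable.pred M (\<lambda>\<omega>. trace_event lam Q n m p (X 0 \<omega>) (X 1 \<omega>) (X 2 \<omega>))" by simp
  then have "{\<omega> \<in> space M. trace_event lam Q n m p (X 0 \<omega>) (X 1 \<omega>) (X 2 \<omega>)} \<in> sets M"
    by (simp add: pred_def)
  also have "{\<omega> \<in> space M. trace_event lam Q n m p (X 0 \<omega>) (X 1 \<omega>) (X 2 \<omega>)} = trace lam Q -` {y} \<inter> space M"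
    using trace_eq_iff[OF _ p, of _ lam Q m] by (auto simp: y X_simps simp del: One_nat_def)
  finally show "trace lam Q -` {y} \<inter> space M \<in> sets M" .
qed

text \<open>The trace has countably many values and the integrand is nonnegative, so the sum over
  the values may be exchanged with the integral. On each piece the trace argument of
  \<open>F\<close> is frozen, leaving a function of the arrivals.\<close>

lemma nn_integral_trace:
  assumes char: "pdp_characteristics \<Phi>' lam Q"
    and F: "\<And>y. y \<in> traces \<Longrightarrow> F y \<in> borel_measurable seq_space"
  shows "(\<integral>\<^sup>+\<omega>. F (trace lam Q \<omega>) (X 0 \<omega>) \<partial>M) =
    (\<integral>\<^sup>+y. \<integral>\<^sup>+\<omega>. F y (X 0 \<omega>) * indicator {\<omega>. trace lam Q \<omega> = y} \<omega> \<partial>M \<partial>count_space traces)"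
proof -
  note [measurable] = measurable_trace[OF char]
  have FX [measurable]: "(\<lambda>\<omega>. F y (X 0 \<omega>)) \<in> borel_measurable M" if "y \<in> traces" for y
    using X_measurable[of 0] F[OF that] by simp
  have "(\<integral>\<^sup>+\<omega>. F (trace lam Q \<omega>) (X 0 \<omega>) \<partial>M) =
      (\<integral>\<^sup>+\<omega>. \<integral>\<^sup>+y. F y (X 0 \<omega>) * indicator {\<omega>. trace lam Q \<omega> = y} \<omega> \<partial>count_space traces \<partial>M)"
  proof (rule nn_integral_cong)
    fix \<omega>
    have "(\<integral>\<^sup>+y. F y (X 0 \<omega>) * indicator {\<omega>. trace lam Q \<omega> = y} \<omega> \<partial>count_space traces) =
        (\<integral>\<^sup>+y. F y (X 0 \<omega>) * indicator {trace lam Q \<omega>} y \<partial>count_space traces)"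
      by (intro nn_integral_cong) (auto simp: indicator_def)
    also have "\<dots> = F (trace lam Q \<omega>) (X 0 \<omega>)"
      using trace_in_traces[of lam Q \<omega>] by (subst nn_integral_indicator_singleton) auto
    finally show "F (trace lam Q \<omega>) (X 0 \<omega>) =
        (\<integral>\<^sup>+y. F y (X 0 \<omega>) * indicator {\<omega>. trace lam Q \<omega> = y} \<omega> \<partial>count_space traces)" ..
  qed
  also have "\<dots> = (\<integral>\<^sup>+y. \<integral>\<^sup>+\<omega>. F y (X 0 \<omega>) * indicator {\<omega>. trace lam Q \<omega> = y} \<omega> \<partial>M \<partial>count_space traces)"
  proof (rule nn_integral_count_space_nn_integral[OF countable_traces])
    fix y assume y: "y \<in> traces"
    have "Measurable.pred M (\<lambda>\<omega>. trace lam Q \<omega> = y)"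
      using measurable_compose[OF measurable_trace[OF char], of "\<lambda>z. z = y" "count_space UNIV"] by simp
    then have "(\<lambda>\<omega>. if trace lam Q \<omega> = y then F y (X 0 \<omega>) else 0) \<in> borel_measurable M"
      using FX[OF y] by measurable
    also have "(\<lambda>\<omega>. if trace lam Q \<omega> = y then F y (X 0 \<omega>) else 0) =
        (\<lambda>\<omega>. F y (X 0 \<omega>) * indicator {\<omega>. trace lam Q \<omega> = y} \<omega>)" by (auto simp: fun_eq_iff)
    finally show "(\<lambda>\<omega>. F y (X 0 \<omega>) * indicator {\<omega>. trace lam Q \<omega> = y} \<omega>) \<in> borel_measurable M" .
  qed
  finally show ?thesis .
qed

text \<open>Neither \<open>lam\<close> nor \<open>Q\<close> occurs: target and reference share this
  function, and only their traces differ. The branch \<open>t = 0\<close> follows the convention in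
  \<open>pdp\<close>.\<close>

definition final_state where
  "final_state a = (\<lambda>(n, m, p). if t = 0 then x else
     (snd (p n), \<Phi> (snd (p n)) (t - arrivals a (fst (p n))) (path_pos \<Phi> (snd x) (arrivals a) p n)))"

lemma final_state_measurable: "(\<lambda>a. final_state a y) \<in> seq_space \<rightarrow>\<^sub>M state_space"
proof (cases y)
  case (fields n m p)
  have "x \<in> space state_space" by (simp add: state_space_def space_pair_measure)
  moreover have "(\<lambda>a. (snd (p n), \<Phi> (snd (p n)) (t - arrivals a (fst (p n))) (path_pos \<Phi> (snd x) (arrivals a) p n)))
      \<in> seq_space \<rightarrow>\<^sub>M state_space"
    by (intro Pair_state_space flow_measurable') measurable
  ultimately show ?thesis
    unfolding final_state_def fields by (cases "t = 0") auto
qed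

lemma pdp_eq_final_state:
  assumes \<omega>: "\<omega> \<in> space M"
  shows "pdp \<Phi> x (Tstar \<omega>) (thin lam Q \<omega>) t = final_state (X 0 \<omega>) (trace lam Q \<omega>)"
proof -
  interpret thinning_path ls k I \<Phi> lam Q x "Tstar \<omega>" "U \<omega>" "V \<omega>" t "Nstar \<omega> t"
    by (rule thinning_path[OF \<omega>])
  obtain n m p where c: "trace lam Q \<omega> = (n, m, p)" by (rule prod_cases3)
  note * = trace_unfold[OF \<omega> c]
  have "tau (thin lam Q \<omega>) n = fst (p n)" "mode (thin lam Q \<omega>) n = snd (p n)"
    "pos (thin lam Q \<omega>) n = path_pos \<Phi> (snd x) (Tstar \<omega>) p n"
    using *(3)[of n] by (simp_all add: tau_def mode_def pos_def path_seq_def)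
  then show ?thesis
    unfolding pdp_eq[OF *(1)] final_state_def c prod.case X_simps arrivals_restrict[OF \<omega>] by simp
qed

section \<open>Change of measure\<close>

text \<open>For nonnegative test functions, summing over traces reduces the claim to
  \<open>likelihood_ratio_path_weight\<close>. The target side is bounded, so equality of the
  nonnegative integrals also makes the weighted side integrable.\<close>

lemma change_of_measure:
  fixes n :: nat
  assumes char: "pdp_characteristics \<Phi>' lam Q" "pdp_characteristics \<Phi>' lamt Qt"
    and lam: "\<And>y. lam y \<le> ls"
    and lamt: "\<And>\<theta> \<nu>. lamt (\<theta>, \<nu>) = lamt0 \<theta>"
    and Qt: "\<And>\<theta> \<nu> \<theta>'. mode_prob Qt (\<theta>, \<nu>) {\<theta>'} = qt \<theta> \<theta>'"
    and qt: "\<And>\<theta> \<theta>'. 0 < qt \<theta> \<theta>'"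
    and lamt0: "\<And>\<theta>. 0 < lamt0 \<theta> \<and> lamt0 \<theta> < ls"
    and g: "g \<in> borel_measurable state_space" "bounded (range g)"
  defines "GR \<equiv> \<lambda>\<omega>. g (pdp \<Phi> x (Tstar \<omega>) (thin lamt Qt \<omega>) t) *
      likelihood_ratio ls \<Phi> lam Q lamt0 qt (Tstar \<omega>) (Nstar \<omega> t) (thin lamt Qt \<omega>) n *
      indicator {\<omega>. jump_count (Tstar \<omega>) (thin lamt Qt \<omega>) t = n} \<omega>"
    and "GX \<equiv> \<lambda>\<omega>. g (pdp \<Phi> x (Tstar \<omega>) (thin lam Q \<omega>) t) *
      indicator {\<omega>. jump_count (Tstar \<omega>) (thin lam Q \<omega>) t = n} \<omega>"
  shows "integrable M GR" "integrable M GX" "expectation GR = expectation GX"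
proof -
  \<comment> \<open>The cut-off at \<open>n' = n\<close> absorbs the indicator of the jump count, so
    that \<open>GR\<close> becomes a function of arrivals and trace alone; \<open>J\<close> does the
    same for \<open>GX\<close>.\<close>
  define R where "R a = (\<lambda>(n', m, p). if n' = n then
      likelihood_ratio ls \<Phi> lam Q lamt0 qt (arrivals a) m (path_seq \<Phi> (snd x) (arrivals a) p) n else 0)" for a
  define J :: "nat \<times> nat \<times> (nat \<Rightarrow> nat \<times> 'k) \<Rightarrow> real" where "J = (\<lambda>(n', m, p). of_bool (n' = n))"
  define GR' where "GR' h \<omega> = h (final_state (X 0 \<omega>) (trace lamt Qt \<omega>)) * R (X 0 \<omega>) (trace lamt Qt \<omega>)"
    for h :: "'k \<times> real \<Rightarrow> real" and \<omega>
  define GX' where "GX' h \<omega> = h (final_state (X 0 \<omega>) (trace lam Q \<omega>)) * J (trace lam Q \<omega>)"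
    for h :: "'k \<times> real \<Rightarrow> real" and \<omega>
  have GR: "GR \<omega> = GR' g \<omega>" if \<omega>: "\<omega> \<in> space M" for \<omega>
  proof -
    obtain n' m p where c: "trace lamt Qt \<omega> = (n', m, p)" by (rule prod_cases3)
    note * = trace_unfold[OF \<omega> c]
    have "likelihood_ratio ls \<Phi> lam Q lamt0 qt (Tstar \<omega>) m (thin lamt Qt \<omega>) n =
        likelihood_ratio ls \<Phi> lam Q lamt0 qt (Tstar \<omega>) m (path_seq \<Phi> (snd x) (Tstar \<omega>) p) n" if "n' = n"
      by (rule likelihood_ratio_cong) (use *(3) that in simp)
    then show ?thesis
      unfolding GR_def GR'_def pdp_eq_final_state[OF \<omega>] using *(1,2)
      by (simp add: c R_def X_simps(1) arrivals_restrict[OF \<omega>] del: One_nat_def)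
  qed
  have GX: "GX \<omega> = GX' g \<omega>" if \<omega>: "\<omega> \<in> space M" for \<omega>
  proof -
    obtain n' m p where c: "trace lam Q \<omega> = (n', m, p)" by (rule prod_cases3)
    show ?thesis
      unfolding GX_def GX'_def pdp_eq_final_state[OF \<omega>] using trace_unfold(1)[OF \<omega> c]
      by (simp add: c J_def)
  qed
  have R_meas: "(\<lambda>a. R a y) \<in> borel_measurable seq_space" for y
    using likelihood_ratio_measurable[OF char(1)] by (cases y) (simp add: R_def)
  have R_nonneg: "0 \<le> R a y" for a y
  proof -
    have "0 < lam y" for y using char(1) unfolding pdp_characteristics_def by blast
    note likelihood_ratio_nonneg[of lam ls qt lamt0, OF this lam qt lamt0]
    then show ?thesis by (cases y) (simp add: R_def)
  qed
  have meas: "(\<lambda>a. h (final_state a y)) \<in> borel_measurable seq_space"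
    if "h \<in> borel_measurable state_space" for h y
    by (rule measurable_compose[OF final_state_measurable that])
  have X0: "X 0 \<in> M \<rightarrow>\<^sub>M seq_space" by (rule X_measurable) simp
  have GR'_meas: "GR' h \<in> borel_measurable M" if "h \<in> borel_measurable state_space" for h
    unfolding GR'_def
  proof (rule measurable_compose_countable'[OF _ measurable_trace[OF char(2)] countable_traces])
    fix y
    show "(\<lambda>\<omega>. h (final_state (X 0 \<omega>) y) * R (X 0 \<omega>) y) \<in> borel_measurable M"
      by (intro borel_measurable_times measurable_compose[OF X0 meas[OF that]] measurable_compose[OF X0 R_meas])
  qed
  have GX'_meas: "GX' h \<in> borel_measurable M" if "h \<in> borel_measurable state_space" for h
    unfolding GX'_def
  proof (rule measurable_compose_countable'[OF _ measurable_trace[OF char(1)] countable_traces])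
    fix y
    show "(\<lambda>\<omega>. h (final_state (X 0 \<omega>) y) * J y) \<in> borel_measurable M"
      by (intro borel_measurable_times measurable_compose[OF X0 meas[OF that]] borel_measurable_const)
  qed
  have nn: "(\<integral>\<^sup>+\<omega>. ennreal (GR' h \<omega>) \<partial>M) = (\<integral>\<^sup>+\<omega>. ennreal (GX' h \<omega>) \<partial>M)"
    if h: "h \<in> borel_measurable state_space" "\<And>y. 0 \<le> h y" for h
  proof -
    let ?FR = "\<lambda>y a. ennreal (h (final_state a y) * R a y)"
    let ?FX = "\<lambda>y a. ennreal (h (final_state a y) * J y)"
    have FR: "?FR y \<in> borel_measurable seq_space" for y
      by (intro measurable_compose[OF _ measurable_ennreal] borel_measurable_times meas[OF h(1)] R_meas)
    have FX: "?FX y \<in> borel_measurable seq_space" for y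
      by (intro measurable_compose[OF _ measurable_ennreal] borel_measurable_times meas[OF h(1)] borel_measurable_const)
    have "(\<integral>\<^sup>+\<omega>. ?FR y (X 0 \<omega>) * indicator {\<omega>. trace lamt Qt \<omega> = y} \<omega> \<partial>M) =
        (\<integral>\<^sup>+\<omega>. ?FX y (X 0 \<omega>) * indicator {\<omega>. trace lam Q \<omega> = y} \<omega> \<partial>M)" if y_in: "y \<in> traces" for y
    proof -
      obtain n' m p where y: "y = (n', m, p)" and p: "p \<in> extensional {..n'}"
        using y_in by (auto simp: traces_def PiE_def)
      let ?W = "\<lambda>lam Q a. path_weight ls \<Phi> lam Q (snd x) (arrivals a) n' m p"
      have "lamt z \<le> ls" for z using lamt lamt0 by (cases z) (simp add: less_imp_le)
      note laws = trace_law[OF char(2) this p FR[of y], of m] trace_law[OF char(1) lam p FX[of y], of m]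
      have "?FR y a * ennreal (?W lamt Qt a) = ?FX y a * ennreal (?W lam Q a)" for a
      proof (cases "n' = n")
        case True
        have "R a y * ?W lamt Qt a = ?W lam Q a"
        proof -
          have "likelihood_ratio ls \<Phi> lam Q lamt0 qt (arrivals a) m (path_seq \<Phi> (snd x) (arrivals a) p) n *
              ?W lamt Qt a = ?W lam Q a"
            unfolding True by (rule likelihood_ratio_path_weight) (simp_all add: lamt Qt qt lamt0)
          then show ?thesis by (simp add: R_def y True)
        qed
        then show ?thesis
          using R_nonneg[of a y] h(2)
          by (simp add: ennreal_mult'[symmetric] mult.assoc J_def y True)
      qed (simp add: R_def J_def y)
      \<comment> \<open>Here \<open>i\<close> stands for the indicator that \<open>trace_law\<close>
        puts between the two factors.\<close>
      then have eq: "?FR y a * i * ennreal (?W lamt Qt a) = ?FX y a * i * ennreal (?W lam Q a)" for a i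
        unfolding mult.assoc mult.commute[of i] unfolding mult.assoc[symmetric] by (rule arg_cong)
      show ?thesis unfolding y laws[unfolded y] eq[unfolded y] ..
    qed
    then show ?thesis
      unfolding GR'_def GX'_def
        nn_integral_trace[OF char(2), of ?FR, OF FR] nn_integral_trace[OF char(1), of ?FX, OF FX]
      by (rule nn_integral_cong) (simp only: space_count_space)
  qed
  have pos: "integrable M (GR' h) \<and> integrable M (GX' h) \<and> expectation (GR' h) = expectation (GX' h)"
    if h: "h \<in> borel_measurable state_space" "\<And>y. 0 \<le> h y" "\<And>y. h y \<le> C" for h C
  proof -
    have GX'_bound: "0 \<le> GX' h \<omega> \<and> GX' h \<omega> \<le> C" for \<omega>
      using h(2,3)[of "final_state (X 0 \<omega>) (trace lam Q \<omega>)"]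
      by (cases "trace lam Q \<omega>") (auto simp: GX'_def J_def)
    have iX: "integrable M (GX' h)"
      by (rule integrable_const_bound[of _ C]) (use GX'_bound GX'_meas[OF h(1)] in auto)
    have GR'_nonneg: "0 \<le> GR' h \<omega>" for \<omega> using h(2) R_nonneg by (simp add: GR'_def)
    have "integrable M (GR' h)"
      using iX nn[OF h(1,2)] GX'_bound GR'_nonneg GR'_meas[OF h(1)]
      by (simp add: integrable_iff_bounded)
    moreover have "expectation (GR' h) = expectation (GX' h)"
      using nn[OF h(1,2)] GX'_bound GR'_nonneg GR'_meas[OF h(1)] GX'_meas[OF h(1)]
      by (simp add: integral_eq_nn_integral)
    ultimately show ?thesis using iX by simp
  qed
  obtain C where C: "\<And>y. \<bar>g y\<bar> \<le> C" using g(2) by (auto simp: bounded_iff)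
  have "0 \<le> C" using C[of x] by simp
  \<comment> \<open>A bounded \<open>g\<close> is the difference of \<open>g + C\<close> and
    \<open>C\<close>, both nonnegative and bounded, and \<open>GR'\<close> and \<open>GX'\<close>
    are linear in the test function.\<close>
  have 1: "integrable M (GR' (\<lambda>y. g y + C)) \<and> integrable M (GX' (\<lambda>y. g y + C)) \<and>
      expectation (GR' (\<lambda>y. g y + C)) = expectation (GX' (\<lambda>y. g y + C))"
  proof (rule pos)
    show "(\<lambda>y. g y + C) \<in> borel_measurable state_space" using g(1) by simp
    show "0 \<le> g y + C" "g y + C \<le> 2 * C" for y using C[of y] by auto
  qed
  have 2: "integrable M (GR' (\<lambda>y. C)) \<and> integrable M (GX' (\<lambda>y. C)) \<and>
      expectation (GR' (\<lambda>y. C)) = expectation (GX' (\<lambda>y. C))"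
    by (rule pos[of _ C]) (use \<open>0 \<le> C\<close> in auto)
  have GR'_diff: "GR' g = (\<lambda>\<omega>. GR' (\<lambda>y. g y + C) \<omega> - GR' (\<lambda>y. C) \<omega>)"
    by (simp add: GR'_def fun_eq_iff algebra_simps)
  have GX'_diff: "GX' g = (\<lambda>\<omega>. GX' (\<lambda>y. g y + C) \<omega> - GX' (\<lambda>y. C) \<omega>)"
    by (simp add: GX'_def fun_eq_iff algebra_simps)
  have int: "integrable M (GR' g)" "integrable M (GX' g)"
    unfolding GR'_diff GX'_diff using 1 2 by auto
  have eq: "expectation (GR' g) = expectation (GX' g)"
    unfolding GR'_diff GX'_diff using 1 2 by simp
  have "integrable M GR \<longleftrightarrow> integrable M (GR' g)" "integrable M GX \<longleftrightarrow> integrable M (GX' g)"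
    by (rule Bochner_Integration.integrable_cong[OF refl], erule GR GX)+
  with int show "integrable M GR" "integrable M GX" by simp_all
  have "expectation GR = expectation (GR' g)" "expectation GX = expectation (GX' g)"
    by (rule Bochner_Integration.integral_cong[OF refl], erule GR GX)+
  with eq show "expectation GR = expectation GX" by simp
qed

end

section \<open>Clipped flows and the main theorem\<close>

text \<open>The flow is only assumed measurable for nonnegative times; clipping the time argument makes
  it measurable everywhere and does not affect the construction.\<close>

context thinning_path
begin

abbreviation \<Phi>' where "\<Phi>' \<equiv> \<lambda>\<theta> s \<nu>. \<Phi> \<theta> (max 0 s) \<nu>"

lemma flow_max: "i \<le> j \<Longrightarrow> \<Phi>' \<theta> (T j - T i) \<nu> = \<Phi> \<theta> (T j - T i) \<nu>"
  using strict_mono_less_eq[OF strict_mono_T, of i j] by (simp add: max_def)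

text \<open>Thinning evaluates the flow only at arrivals after the current jump, where time
  differences are nonnegative.\<close>

lemma thinning_max: "thinning l k I \<Phi>' lam Q x T U V = S"
proof
  fix n show "thinning l k I \<Phi>' lam Q x T U V n = S n"
  proof (induction n)
    case (Suc n)
    obtain \<tau> \<theta> \<nu> where S: "S n = (\<tau>, \<theta>, \<nu>)" by (rule prod_cases3)
    \<comment> \<open>For \<tau> = \<infinity> no \<open>j\<close> satisfies the premise, so the
      default value of \<open>the_enat\<close> does no harm.\<close>
    have flow: "\<Phi>' \<theta> (T j - T (the_enat \<tau>)) \<nu> = \<Phi> \<theta> (T j - T (the_enat \<tau>)) \<nu>" if "\<tau> < enat j" for j
      using that by (intro flow_max) (cases \<tau>, auto)
    let ?P = "\<lambda>j. \<tau> < enat j \<and> U j * l \<le> lam (\<theta>, \<Phi> \<theta> (T j - T (the_enat \<tau>)) \<nu>)"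
    have eq: "{enat j | j. \<tau> < enat j \<and> U j * l \<le> lam (\<theta>, \<Phi>' \<theta> (T j - T (the_enat \<tau>)) \<nu>)} = {enat j | j. ?P j}"
      using flow by (intro Collect_cong) (metis (no_types, lifting))
    show ?case
    proof (cases "Inf {enat j | j. ?P j}")
      case (enat j)
      then have "\<tau> < enat j" unfolding Inf_enat_eq_enat_iff by blast
      then show ?thesis
        unfolding thinning.simps(2) Suc.IH S Let_def prod.case eq enat enat.case using flow by simp
    next
      case infinity
      then show ?thesis unfolding thinning.simps(2) Suc.IH S Let_def prod.case eq infinity by simp
    qed
  qed simp
qed

lemma pdp_max: "pdp \<Phi>' x T S t = pdp \<Phi> x T S t"
proof -
  interpret P: thinning_path l k I \<Phi>' lam Q x T U V t m by unfold_locales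
  define n where "n = jump_count T S t"
  have n: "jump_count T S t = n" by (simp add: n_def)
  have "0 \<le> t - T (tau S n)" using fst_thinning_eq_tau(2)[OF n, of n] T_le_t_iff by simp
  then have "max 0 (t - T (tau S n)) = t - T (tau S n)" by simp
  then show ?thesis
    using P.pdp_eq[unfolded thinning_max, OF n] pdp_eq[OF n] by (simp only:)
qed

text \<open>On the event that the count is \<open>n\<close>, the indices \<open>tau S i\<close>
  increase up to \<open>i = n\<close>, so both kinds of factor evaluate the flow at arrivals from
  \<open>tau S i\<close> onwards. Beyond \<open>n\<close>, \<open>tau\<close> may be a default of
  \<open>the_enat\<close>.\<close>

lemma likelihood_ratio_max:
  assumes n: "jump_count T S t = n"
  shows "likelihood_ratio l \<Phi>' lam' Q' lamt qt T m S n = likelihood_ratio l \<Phi> lam' Q' lamt qt T m S n"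
proof -
  have r: "rate_at \<Phi>' lam' T S i q = rate_at \<Phi> lam' T S i q" if "tau S i \<le> q" for i q
    unfolding rate_at_def flow_max[OF that] ..
  have "Z_inner l \<Phi>' lam' Q' lamt qt T S i = Z_inner l \<Phi> lam' Q' lamt qt T S i" if "i < n" for i
    using tau_less_tau_Suc[OF n that] by (simp add: Z_inner_def r)
  moreover have "Z_last l \<Phi>' lam' Q' lamt qt T m S n = Z_last l \<Phi> lam' Q' lamt qt T m S n"
    by (simp add: Z_last_def r)
  ultimately show ?thesis by (simp add: likelihood_ratio_def)
qed

end

lemma flow_max_measurable:
  assumes "pdp_characteristics \<Phi> lam Q"
  shows "(\<lambda>(s, \<nu>). \<Phi> \<theta> (max 0 s) \<nu>) \<in> borel_measurable (borel \<Otimes>\<^sub>M borel)"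
proof -
  have "(\<lambda>(t, \<nu>). \<Phi> \<theta> t \<nu>) \<in> borel_measurable (restrict_space borel {0..} \<Otimes>\<^sub>M borel)"
    using assms by (simp add: pdp_characteristics_def)
  moreover have "(\<lambda>z. (max 0 (fst z), snd z)) \<in> borel \<Otimes>\<^sub>M borel \<rightarrow>\<^sub>M restrict_space borel {0::real..} \<Otimes>\<^sub>M (borel :: real measure)"
    by (intro measurable_Pair measurable_restrict_space2) auto
  ultimately have "(\<lambda>z. (\<lambda>(t, \<nu>). \<Phi> \<theta> t \<nu>) (max 0 (fst z), snd z)) \<in> borel_measurable (borel \<Otimes>\<^sub>M borel)"
    by (rule measurable_compose[rotated])
  then show ?thesis by (simp add: case_prod_beta)
qed

text \<open>Integrability is claimed along with the identity because the Bochner integral of a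
  nonintegrable function is 0 by convention, so the equation alone would say less.\<close>

theorem proposition2p2:
  fixes M :: "'w measure"
    and k :: "nat \<Rightarrow> 'k" and I :: "nat set"
    and \<Phi> :: "'k \<Rightarrow> real \<Rightarrow> real \<Rightarrow> real"
    and lam lamt :: "'k \<times> real \<Rightarrow> real"
    and Q Qt :: "'k \<times> real \<Rightarrow> ('k \<times> real) measure"
    and lamt\<^sub>0 :: "'k \<Rightarrow> real" and qt :: "'k \<Rightarrow> 'k \<Rightarrow> real"
    and ls t Tmax :: real
    and Nstar :: "'w \<Rightarrow> real \<Rightarrow> nat" and Tstar U V :: "'w \<Rightarrow> nat \<Rightarrow> real"
    and x :: "'k \<times> real" and g :: "'k \<times> real \<Rightarrow> real" and n :: nat
  assumes "prob_space M"
    and "prob_space.thinning_data M ls Nstar Tstar U V"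
    and "enumeration k I"
    and "pdp_characteristics \<Phi> lam Q"
    and "\<And>y. lam y \<le> ls"
    and "pdp_characteristics \<Phi> lamt Qt"
    and "\<And>\<theta> \<nu>. lamt (\<theta>, \<nu>) = lamt\<^sub>0 \<theta>"
    and "\<And>\<theta> \<nu> \<theta>'. mode_prob Qt (\<theta>, \<nu>) {\<theta>'} = qt \<theta> \<theta>'"
    and "\<And>\<theta> \<theta>'. 0 < qt \<theta> \<theta>'"
    and "\<And>\<theta>. 0 < lamt\<^sub>0 \<theta> \<and> lamt\<^sub>0 \<theta> < ls"
    and "t \<in> {0..Tmax}"
    and "g \<in> borel_measurable state_space" and "bounded (range g)"
  shows
    "let S = (\<lambda>\<omega>. thinning ls k I \<Phi> lam Q x (Tstar \<omega>) (U \<omega>) (V \<omega>));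
         St = (\<lambda>\<omega>. thinning ls k I \<Phi> lamt Qt x (Tstar \<omega>) (U \<omega>) (V \<omega>));
         X = (\<lambda>\<omega>. pdp \<Phi> x (Tstar \<omega>) (S \<omega>) t);
         Xt = (\<lambda>\<omega>. pdp \<Phi> x (Tstar \<omega>) (St \<omega>) t);
         N = (\<lambda>\<omega>. jump_count (Tstar \<omega>) (S \<omega>) t);
         Nt = (\<lambda>\<omega>. jump_count (Tstar \<omega>) (St \<omega>) t);
         R = (\<lambda>\<omega>. likelihood_ratio ls \<Phi> lam Q lamt\<^sub>0 qt (Tstar \<omega>) (Nstar \<omega> t) (St \<omega>) n)
     in integrable M (\<lambda>\<omega>. g (Xt \<omega>) * R \<omega> * indicator {\<omega>. Nt \<omega> = n} \<omega>) \<and>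
        integrable M (\<lambda>\<omega>. g (X \<omega>) * indicator {\<omega>. N \<omega> = n} \<omega>) \<and>
        prob_space.expectation M (\<lambda>\<omega>. g (Xt \<omega>) * R \<omega> * indicator {\<omega>. Nt \<omega> = n} \<omega>) =
        prob_space.expectation M (\<lambda>\<omega>. g (X \<omega>) * indicator {\<omega>. N \<omega> = n} \<omega>)"
proof -
  let ?\<Phi> = "\<lambda>\<theta> s \<nu>. \<Phi> \<theta> (max 0 s) \<nu>"
  interpret prob_space M by (rule assms(1))
  \<comment> \<open>The probabilistic argument runs for the clipped flow; the equalities
    \<open>GR\<close> and \<open>GX\<close> return to \<open>\<Phi>\<close> on
    \<open>space M\<close>.\<close>
  interpret thinned_poisson M ls Nstar Tstar U V k I ?\<Phi> x t
    using assms(2,3,11) flow_max_measurable[OF assms(4)] by unfold_locales auto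
  let ?S = "\<lambda>lam Q \<omega>. thinning ls k I \<Phi> lam Q x (Tstar \<omega>) (U \<omega>) (V \<omega>)"
  let ?GR = "\<lambda>\<omega>. g (pdp \<Phi> x (Tstar \<omega>) (?S lamt Qt \<omega>) t) *
      likelihood_ratio ls \<Phi> lam Q lamt\<^sub>0 qt (Tstar \<omega>) (Nstar \<omega> t) (?S lamt Qt \<omega>) n *
      indicator {\<omega>. jump_count (Tstar \<omega>) (?S lamt Qt \<omega>) t = n} \<omega>"
  let ?GX = "\<lambda>\<omega>. g (pdp \<Phi> x (Tstar \<omega>) (?S lam Q \<omega>) t) *
      indicator {\<omega>. jump_count (Tstar \<omega>) (?S lam Q \<omega>) t = n} \<omega>"
  let ?GR' = "\<lambda>\<omega>. g (pdp ?\<Phi> x (Tstar \<omega>) (thin lamt Qt \<omega>) t) *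
      likelihood_ratio ls ?\<Phi> lam Q lamt\<^sub>0 qt (Tstar \<omega>) (Nstar \<omega> t) (thin lamt Qt \<omega>) n *
      indicator {\<omega>. jump_count (Tstar \<omega>) (thin lamt Qt \<omega>) t = n} \<omega>"
  let ?GX' = "\<lambda>\<omega>. g (pdp ?\<Phi> x (Tstar \<omega>) (thin lam Q \<omega>) t) *
      indicator {\<omega>. jump_count (Tstar \<omega>) (thin lam Q \<omega>) t = n} \<omega>"
  have path: "thinning_path (Tstar \<omega>) t (Nstar \<omega> t)" if "\<omega> \<in> space M" for \<omega>
    using that by (rule thinning_path)
  have GR: "?GR' \<omega> = ?GR \<omega>" if "\<omega> \<in> space M" for \<omega>
  proof -
    interpret P: thinning_path ls k I \<Phi> lamt Qt x "Tstar \<omega>" "U \<omega>" "V \<omega>" t "Nstar \<omega> t"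
      by (rule path[OF that])
    \<comment> \<open>Off the event both sides vanish with the indicator; on it
      \<open>likelihood_ratio_max\<close> applies.\<close>
    show ?thesis unfolding indicator_def mem_Collect_eq P.thinning_max P.pdp_max
      using P.likelihood_ratio_max[of n] by (cases "jump_count (Tstar \<omega>) P.S t = n") simp_all
  qed
  have GX: "?GX' \<omega> = ?GX \<omega>" if "\<omega> \<in> space M" for \<omega>
  proof -
    interpret P: thinning_path ls k I \<Phi> lam Q x "Tstar \<omega>" "U \<omega>" "V \<omega>" t "Nstar \<omega> t"
      by (rule path[OF that])
    show ?thesis unfolding indicator_def mem_Collect_eq P.thinning_max P.pdp_max ..
  qed
  have *: "integrable M ?GR'" "integrable M ?GX'" "expectation ?GR' = expectation ?GX'"
    by (rule change_of_measure[OF assms(4,6,5,7-10,12,13)])+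
  have "integrable M ?GR' \<longleftrightarrow> integrable M ?GR" "integrable M ?GX' \<longleftrightarrow> integrable M ?GX"
    by (rule Bochner_Integration.integrable_cong[OF refl], erule GR GX)+
  moreover have "expectation ?GR' = expectation ?GR" "expectation ?GX' = expectation ?GX"
    by (rule Bochner_Integration.integral_cong[OF refl], erule GR GX)+
  ultimately show ?thesis unfolding Let_def using * by (intro conjI) (simp_all only:)
qed

end
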